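(* Let $\gamma>1$, $\eta>0$ and $Q>1$ be fixed constants, and let $\delta=\delta(\gamma,\eta,Q)>0$ be a fixed number such that, for every sequence in $B_0(\gamma,\eta,Q)$, the associated CMV operator has no resonances in the disk $\{z\in\mathbb{C}:|z|<1+\delta\}$. Suppose $\alpha$ and $\breve\alpha$ are two sequences of Verblunsky coefficients in $B_0(\gamma,\eta,Q)$ and $U$ and $\breve U$ are the associated CMV operators. Further suppose that, for two numbers $R>1$ and $\varepsilon\in(0,\delta/2)$, the resonances of $U$ and $\breve U$ in the disk $|z|<R$, if there are any, are respectively $\varepsilon$-close. Then there is a constant $A_0$, depending only on $\gamma$, $\eta$ and $Q$, such that $$|\alpha_n-\breve\alpha_n|\le A_0\,(6Q^2)^{n}\left(\varepsilon+\frac{(\log R)^{\gamma/(\gamma-1)}}{R}\right)\qquad\text{for all } n\in\mathbb{N}.$$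
   Context: $\mathbb{D}$ is the open unit disk in $\mathbb{C}$, $\mathbb{N}=\{1,2,\dots\}$, $\mathbb{N}_0=\{0,1,2,\dots\}$. Class $B_0(\gamma,\eta,Q)$: the set of all sequences $\alpha:\mathbb{N}\to\mathbb{D}$ (Verblunsky coefficients) such that (1) $|\alpha_k|\le \eta\exp(-k^\gamma)$ for all $k\in\mathbb{N}$, and (2) $\prod_{j=1}^\infty(1-|\alpha_j|)\ge 1/Q$. CMV operator: with $\rho_k=\sqrt{1-|\alpha_k|^2}$ and $\Theta_k=\begin{pmatrix}-\alpha_k&\rho_k\\ \rho_k&\overline{\alpha_k}\end{pmatrix}$, put $W=\bigoplus_{k=1}^\infty\Theta_{2k-1}$ and $V=1\oplus\bigoplus_{k=1}^\infty\Theta_{2k}$ (where $1$ is a $1\times1$ block). The CMV operator associated with $\alpha$ is the unitary operator $U=VW$ on $\ell^2(\mathbb{N}_0)$. Jost function and resonances: let $\zeta_k=z$ for $k$ odd and $\zeta_k=1$ for $k$ even. For $\alpha$ satisfying (1) and every $z\in\mathbb{C}$, the Volterra-type equations $$F(z,k)=\begin{pmatrix}1\\0\end{pmatrix}-\sum_{n=k+1}^\infty\begin{pmatrix}0&\alpha_n\zeta_n\\ z^{n-k-1}\,\overline{\alpha_n}\,\zeta_{k+1}&0\end{pmatrix}F(z,n),\qquad k\in\mathbb{N}_0,$$ have a unique solution $F(z,\cdot):\mathbb{N}_0\to\mathbb{C}^2$, and the components of $F(\cdot,k)$ are entire functions of $z$. The Jost function is the entire function $\psi_0(z)=C_0\,(1,-1)F(z,0)$,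 i.e. $C_0$ times the difference (first component minus second component) of $F(z,0)$, where $C_0=\prod_{j=1}^\infty\rho_j^{-1}$. The resonances of $U$ are the zeros of $\psi_0$ in $\mathbb{C}$, listed with multiplicity. Respectively $\varepsilon$-close: two collections $\{z_1,\dots,z_N\}$ and $\{\breve z_1,\dots,\breve z_N\}$ of complex numbers (with the same number $N$ of elements, repeated according to multiplicity) are respectively $\varepsilon$-close if, in a suitable enumeration, $|z_n-\breve z_n|<\varepsilon$ for all $n\in\{1,\dots,N\}$. In the hypothesis this means that $U$ and $\breve U$ have the same number $N\ge0$ of resonances in $|z|<R$ and these are respectively $\varepsilon$-close (no condition if $N=0$).
   Formalization: The estimate is proved for all R ≥ R₀ with any fixed R₀ > 1, and A₀ may depend on R₀ as well as γ, η, Q; a constant uniform for all R > 1 is impossible, since as R → 1 and ε → 0 the closeness condition is empty and the bound tends to 0. *)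

theory Defs
  imports "HOL-Complex_Analysis.Complex_Analysis"
begin

text \<open>
  A sequence \<open>(\<alpha>\<^sub>k)\<close> indexed by \<open>k = 1, 2, \<dots>\<close> is a function on \<^typ>\<open>nat\<close> whose value at \<open>0\<close>
  is never used.
\<close>

definition verblunsky_seq :: "(nat \<Rightarrow> complex) \<Rightarrow> bool" where
  "verblunsky_seq \<alpha> \<longleftrightarrow> (\<forall>k\<ge>1. cmod (\<alpha> k) < 1)"

definition B0 :: "real \<Rightarrow> real \<Rightarrow> real \<Rightarrow> (nat \<Rightarrow> complex) set" where
  "B0 \<gamma> \<eta> Q = {\<alpha>. verblunsky_seq \<alpha> \<and>
     (\<forall>k\<ge>1. cmod (\<alpha> k) \<le> \<eta> * exp (- (real k powr \<gamma>))) \<and>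
     (\<Prod>j. 1 - cmod (\<alpha> (Suc j))) \<ge> 1 / Q}"


subsection \<open>CMV operators\<close>

definition rho :: "(nat \<Rightarrow> complex) \<Rightarrow> nat \<Rightarrow> real" where
  "rho \<alpha> k = sqrt (1 - (cmod (\<alpha> k))\<^sup>2)"

definition Theta :: "(nat \<Rightarrow> complex) \<Rightarrow> nat \<Rightarrow> complex^2^2" where
  "Theta \<alpha> k = vector [vector [- \<alpha> k, of_real (rho \<alpha> k)],
                         vector [of_real (rho \<alpha> k), cnj (\<alpha> k)]]"

text \<open>
  The block \<open>\<Theta>\<^bsub>2k-1\<^esub>\<close> of \<open>W\<close> acts on the coordinates \<open>2k-2, 2k-1\<close>, and the block \<open>\<Theta>\<^bsub>2k\<^esub>\<close> of \<open>V\<close>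
  acts on the coordinates \<open>2k-1, 2k\<close>; in both cases \<open>\<Theta>\<^sub>j\<close> acts on the coordinates \<open>j-1, j\<close>.
\<close>

definition cmv_W :: "(nat \<Rightarrow> complex) \<Rightarrow> (nat \<Rightarrow> complex) \<Rightarrow> nat \<Rightarrow> complex" where
  "cmv_W \<alpha> u n =
     (if even n then (Theta \<alpha> (n + 1) *v vector [u n, u (n + 1)]) $ 1
      else (Theta \<alpha> n *v vector [u (n - 1), u n]) $ 2)"

definition cmv_V :: "(nat \<Rightarrow> complex) \<Rightarrow> (nat \<Rightarrow> complex) \<Rightarrow> nat \<Rightarrow> complex" where
  "cmv_V \<alpha> u n =
     (if n = 0 then u 0
      else if odd n then (Theta \<alpha> (n + 1) *v vector [u n, u (n + 1)]) $ 1
      else (Theta \<alpha> n *v vector [u (n - 1), u n]) $ 2)"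

definition ell2 :: "(nat \<Rightarrow> complex) set" where
  "ell2 = {u. summable (\<lambda>n. (cmod (u n))\<^sup>2)}"

definition cmv :: "(nat \<Rightarrow> complex) \<Rightarrow> (nat \<Rightarrow> complex) \<Rightarrow> (nat \<Rightarrow> complex)" where
  "cmv \<alpha> = (\<lambda>u\<in>ell2. cmv_V \<alpha> (cmv_W \<alpha> u))"

text \<open>
  The Verblunsky coefficients of a CMV operator; they are unique apart from the irrelevant value
  at \<open>0\<close>, see \<open>verblunsky_cmv\<close>.
\<close>

definition verblunsky :: "((nat \<Rightarrow> complex) \<Rightarrow> (nat \<Rightarrow> complex)) \<Rightarrow> nat \<Rightarrow> complex" where
  "verblunsky U = (SOME \<alpha>. verblunsky_seq \<alpha> \<and> U = cmv \<alpha>)"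

lemma vec2_simps [simp]:
  "((vector [vector [a, b], vector [c, d]] :: complex^2^2) *v vector [x, y]) $ 1 = a * x + b * y"
  "((vector [vector [a, b], vector [c, d]] :: complex^2^2) *v vector [x, y]) $ 2 = c * x + d * y"
  by (simp_all add: matrix_vector_mult_def sum_2)

lemma unit_in_ell2: "(\<lambda>n. if n = i then 1 else 0) \<in> ell2"
proof -
  have "summable (\<lambda>n. (cmod (if n = i then 1 else 0))\<^sup>2)"
    by (rule summable_finite[of "{i}"]) auto
  then show ?thesis by (simp add: ell2_def)
qed

lemma cmv_entries:
  "cmv \<alpha> (\<lambda>n. if n = 0 then 1 else 0) 0 = - \<alpha> 1"
  "cmv \<alpha> (\<lambda>n. if n = 2 * m then 1 else 0) (2 * m + 1) = - \<alpha> (2 * m + 2) * rho \<alpha> (2 * m + 1)"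
  "cmv \<alpha> (\<lambda>n. if n = 2 * m + 2 then 1 else 0) (2 * m + 1) = - \<alpha> (2 * m + 3) * rho \<alpha> (2 * m + 2)"
  using unit_in_ell2[of 0] unit_in_ell2[of "2 * m"] unit_in_ell2[of "2 * m + 2"]
  by (simp_all add: cmv_def cmv_V_def cmv_W_def Theta_def numeral_3_eq_3)

lemma rho_nz: "verblunsky_seq \<alpha> \<Longrightarrow> k \<ge> 1 \<Longrightarrow> rho \<alpha> k \<noteq> 0"
  by (metis abs_norm_cancel abs_square_less_1 diff_gt_0_iff_gt order_less_irrefl
      real_sqrt_gt_zero rho_def verblunsky_seq_def)

lemma cmv_inj:
  assumes "verblunsky_seq \<alpha>" "verblunsky_seq \<beta>" "cmv \<alpha> = cmv \<beta>" "k \<ge> 1"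
  shows "\<alpha> k = \<beta> k"
  using \<open>k \<ge> 1\<close>
proof (induction k rule: nat_induct_at_least)
  case base
  show ?case using cmv_entries(1)[of \<alpha>] cmv_entries(1)[of \<beta>] assms(3) by simp
next
  case (Suc k)
  have eq: "rho \<alpha> k = rho \<beta> k" using Suc by (simp add: rho_def)
  have nz: "rho \<beta> k \<noteq> 0" using rho_nz assms(2) Suc by blast
  have "\<alpha> (Suc k) * rho \<alpha> k = \<beta> (Suc k) * rho \<beta> k"
  proof (cases "even k")
    case True
    then obtain j where "k = 2 * j" by blast
    then obtain m where k: "k = 2 * m + 2" using Suc(1) by (cases j) auto
    have "Suc k = 2 * m + 3" using k by simp
    then show ?thesis
      using cmv_entries(3)[of \<alpha> m] cmv_entries(3)[of \<beta> m] assms(3) k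
      by (simp add: numeral_3_eq_3)
  next
    case False
    then obtain m where k: "k = 2 * m + 1" using oddE by blast
    have "Suc k = 2 * m + 2" using k by simp
    then show ?thesis
      using cmv_entries(2)[of \<alpha> m] cmv_entries(2)[of \<beta> m] assms(3) k by simp
  qed
  then show ?case using eq nz by simp
qed

lemma verblunsky_cmv:
  assumes "verblunsky_seq \<alpha>" "k \<ge> 1"
  shows "verblunsky (cmv \<alpha>) k = \<alpha> k"
proof -
  have "verblunsky_seq (verblunsky (cmv \<alpha>)) \<and> cmv \<alpha> = cmv (verblunsky (cmv \<alpha>))"
    unfolding verblunsky_def by (rule someI[of _ \<alpha>]) (use assms in simp)
  then show ?thesis using cmv_inj assms by metis
qed


subsection \<open>Jost function and resonances\<close>

definition zeta :: "complex \<Rightarrow> nat \<Rightarrow> complex" where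
  "zeta z k = (if odd k then z else 1)"

definition volterra_kernel :: "(nat \<Rightarrow> complex) \<Rightarrow> complex \<Rightarrow> nat \<Rightarrow> nat \<Rightarrow> complex^2^2" where
  "volterra_kernel \<alpha> z k n =
     vector [vector [0, \<alpha> n * zeta z n],
             vector [z ^ (n - k - 1) * cnj (\<alpha> n) * zeta z (k + 1), 0]]"

definition volterra_solution :: "(nat \<Rightarrow> complex) \<Rightarrow> complex \<Rightarrow> (nat \<Rightarrow> complex^2) \<Rightarrow> bool" where
  "volterra_solution \<alpha> z F \<longleftrightarrow> (\<forall>k.
     summable (\<lambda>j. volterra_kernel \<alpha> z k (k + 1 + j) *v F (k + 1 + j)) \<and>
     F k = vector [1, 0] - (\<Sum>j. volterra_kernel \<alpha> z k (k + 1 + j) *v F (k + 1 + j)))"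

definition jost_solution :: "(nat \<Rightarrow> complex) \<Rightarrow> complex \<Rightarrow> nat \<Rightarrow> complex^2" where
  "jost_solution \<alpha> z = (THE F. volterra_solution \<alpha> z F)"

definition jost_function ::
    "((nat \<Rightarrow> complex) \<Rightarrow> (nat \<Rightarrow> complex)) \<Rightarrow> complex \<Rightarrow> complex" where
  "jost_function U z =
     (let \<alpha> = verblunsky U; C\<^sub>0 = (\<Prod>j. inverse (rho \<alpha> (Suc j))); F = jost_solution \<alpha> z
      in of_real C\<^sub>0 * (F 0 $ 1 - F 0 $ 2))"

definition resonance :: "((nat \<Rightarrow> complex) \<Rightarrow> (nat \<Rightarrow> complex)) \<Rightarrow> complex \<Rightarrow> bool" where
  "resonance U z \<longleftrightarrow> jost_function U z = 0"

definition resonance_mult :: "((nat \<Rightarrow> complex) \<Rightarrow> (nat \<Rightarrow> complex)) \<Rightarrow> complex \<Rightarrow> nat" where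
  "resonance_mult U z = (if resonance U z then nat (zorder (jost_function U) z) else 0)"

definition lists_resonances ::
    "((nat \<Rightarrow> complex) \<Rightarrow> (nat \<Rightarrow> complex)) \<Rightarrow> real \<Rightarrow> complex list \<Rightarrow> bool" where
  "lists_resonances U R zs \<longleftrightarrow>
     (\<forall>z. count_list zs z = (if cmod z < R then resonance_mult U z else 0))"

text \<open>
  Lists related by \<^const>\<open>list_all2\<close> have the same length, which may be \<open>0\<close>. In particular, closeness
  is no condition at all when the disk of radius \<open>R\<close> contains no resonances of either operator. As
  \<open>(log R)\<^sup>p / R \<rightarrow> 0\<close> for \<open>R \<rightarrow> 1\<close> and \<open>p > 0\<close>, stability estimates with error
  \<open>\<epsilon> + (log R)\<^sup>p / R\<close> can be uniform in \<open>R\<close> only when \<open>R\<close> stays away from \<open>1\<close>.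
\<close>

definition resonances_respectively_close ::
    "real \<Rightarrow> real \<Rightarrow> ((nat \<Rightarrow> complex) \<Rightarrow> (nat \<Rightarrow> complex)) \<Rightarrow>
     ((nat \<Rightarrow> complex) \<Rightarrow> (nat \<Rightarrow> complex)) \<Rightarrow> bool" where
  "resonances_respectively_close \<epsilon> R U U' \<longleftrightarrow>
     (\<exists>zs ws. lists_resonances U R zs \<and> lists_resonances U' R ws \<and>
        list_all2 (\<lambda>z w. cmod (z - w) < \<epsilon>) zs ws)"

end

theory Submission
  imports Defs
begin

text \<open>
  With \<open>\<zeta>\<^sub>k \<zeta>\<^sub>k\<^sub>+\<^sub>1 = z\<close>, the substitution \<open>a\<^sub>k = F\<^sub>1(k)\<close>, \<open>F\<^sub>2(k) = - \<zeta>\<^sub>k\<^sub>+\<^sub>1 b\<^sub>k\<close> turns the Volterra equations into the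
  recursion \<open>a\<^sub>k = a\<^sub>k\<^sub>+\<^sub>1 + \<alpha>\<^sub>k\<^sub>+\<^sub>1 z b\<^sub>k\<^sub>+\<^sub>1\<close>, \<open>b\<^sub>k = cnj \<alpha>\<^sub>k\<^sub>+\<^sub>1 a\<^sub>k\<^sub>+\<^sub>1 + z b\<^sub>k\<^sub>+\<^sub>1\<close>, whose quotients \<open>b\<^sub>k / a\<^sub>k\<close> are
  the Schur functions with first coefficient \<open>cnj \<alpha>\<^sub>k\<^sub>+\<^sub>1\<close>, and \<open>\<psi>\<^sub>0 = C\<^sub>0 \<phi>\<close> with \<open>\<phi> = a\<^sub>0 + z b\<^sub>0\<close>, \<open>\<phi>(0) = 1\<close>.

  Dividing \<open>\<phi>\<close> by the polynomial \<open>P\<close> with its zeros in \<open>\<bar>z\<bar> < R\<close> does not increase the maximum on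
  \<open>\<bar>z\<bar> = 3R\<close>, as each factor of \<open>P\<close> has modulus at least \<open>2\<close> there. Since \<open>log \<bar>\<phi>(z)\<bar> = O((log \<bar>z\<bar>)\<^sup>p)\<close>
  with \<open>p = \<gamma> / (\<gamma> - 1)\<close>, this bounds the number of zeros (the sum of \<open>\<bar>z\<^sub>n\<bar>\<^sup>-\<^sup>2\<close> is bounded uniformly), and the
  Borel--Caratheodory inequality gives \<open>log (\<phi> / P) = O((log R)\<^sup>p / R)\<close> near the unit disk. Hence
  \<open>\<phi> / \<phi>' = 1 + O(err)\<close> near the unit disk, with \<open>err = \<epsilon> + (log R)\<^sup>p / R\<close>.

  The Caratheodory function \<open>\<Phi> = (a\<^sub>0 - z b\<^sub>0) / \<phi>\<close> satisfies \<open>\<Phi> + \<Phi>\<^sup>* = 2 \<kappa> / (\<phi> \<phi>\<^sup>*)\<close>, where \<open>*\<close> denotes the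
  reflection in the unit circle and \<open>\<kappa>\<close> is a constant. So \<open>G = \<Phi> - \<Phi>'\<close> has \<open>G(0) = 0\<close> and \<open>G + G\<^sup>* = O(err)\<close>
  on a circle of radius \<open>r > 1\<close>; as \<open>G\<^sup>*\<close> is controlled there by the values of \<open>G\<close> on the smaller circle
  of radius \<open>1 / r\<close>, the Schwarz lemma yields \<open>G = O(err)\<close>. Finally the error of the Schur functions
  grows at most by the factor \<open>6 Q\<^sup>2\<close> in each step of the Schur algorithm.
\<close>

subsection \<open>Zeros and growth of entire functions\<close>

lemma Schwarz_scaled:
  assumes holf: "f holomorphic_on ball 0 r" and f0: "f 0 = 0" and r: "r > 0"
    and le: "\<And>z. cmod z < r \<Longrightarrow> cmod (f z) \<le> M" and z: "cmod z < r"
  shows "cmod (f z) \<le> M * cmod z / r"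
proof (cases "z = 0")
  case False
  \<comment> \<open>Dividing by \<open>M'\<close> rather than \<open>M\<close> puts the rescaled
    function strictly inside the unit disk, as the Schwarz lemma demands; then \<open>M'\<close>
    decreases to \<open>M\<close>.\<close>
  have "cmod (f z) * r / cmod z \<le> M'" if "M' > M" for M'
  proof -
    have M': "M' > 0" using le[of 0] f0 r that by auto
    define g where "g w = f (of_real r * w) / of_real M'" for w
    have img: "((*) (of_real r)) ` ball 0 1 \<subseteq> ball (0::complex) r"
      using r by (auto simp: norm_mult)
    have "g holomorphic_on ball 0 1"
      unfolding g_def using M'
      by (intro holomorphic_intros holomorphic_on_compose_gen[OF _ holf img, unfolded o_def]) auto
    moreover have "cmod (g w) < 1" if "cmod w < 1" for w
      using le[of "of_real r * w"] that r M' \<open>M' > M\<close>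
      by (simp add: g_def norm_divide norm_mult)
    moreover have "g 0 = 0" by (simp add: g_def f0)
    moreover have "cmod (z / r) < 1" using z r by (simp add: norm_divide)
    ultimately have "cmod (g (z / r)) \<le> cmod (z / r)" using Schwarz_Lemma(1) by blast
    then show ?thesis using r M' False by (simp add: g_def norm_divide field_simps)
  qed
  then have "cmod (f z) * r / cmod z \<le> M" by (rule dense_ge)
  then show ?thesis using r False by (simp add: field_simps)
qed (use f0 in simp)

text \<open>The Moebius map u / (2A - u) fixes 0 and takes the half plane Re u < A into the unit
  disk. Schwarz bounds the image \<open>w\<close>, and solving f = 2A w - f w for |f| gives the
  estimate.\<close>

lemma Borel_Caratheodory_0:
  assumes holf: "f holomorphic_on ball 0 R" and f0: "f 0 = 0"
    and le: "\<And>z. cmod z < R \<Longrightarrow> Re (f z) < A" and z: "cmod z < R"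
  shows "cmod (f z) \<le> 2 * A * cmod z / (R - cmod z)"
proof -
  have R: "R > 0" using z norm_ge_zero[of z] by linarith
  have A: "A > 0" using le[of 0] f0 R by simp
  define w where "w z = f z / (2 * of_real A - f z)" for z
  have nz: "2 * of_real A - f z \<noteq> 0" if "cmod z < R" for z
  proof
    assume "2 * of_real A - f z = 0"
    then have "Re (f z) = 2 * A" by (simp add: complex_eq_iff)
    then show False using le[OF that] A by simp
  qed
  have "w holomorphic_on ball 0 R"
    unfolding w_def using nz by (intro holomorphic_intros holf) auto
  moreover have "cmod (w z) \<le> 1" if "cmod z < R" for z
  proof -
    have "0 \<le> 4 * (A * (A - Re (f z)))" using A le[OF that] by simp
    then have "(cmod (f z))\<^sup>2 \<le> (cmod (2 * of_real A - f z))\<^sup>2"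
      unfolding cmod_power2 by (simp add: power2_eq_square algebra_simps)
    then have "cmod (f z) \<le> cmod (2 * of_real A - f z)"
      using power2_le_imp_le by fastforce
    then show ?thesis using nz[OF that] by (simp add: w_def norm_divide divide_le_eq_1)
  qed
  moreover have "w 0 = 0" by (simp add: w_def f0)
  ultimately have w: "cmod (w z) \<le> 1 * cmod z / R" using Schwarz_scaled[of w R 1 z] R z by blast
  have eq: "f z = 2 * of_real A * w z - f z * w z"
  proof -
    have "2 * of_real A * w z - f z * w z = (2 * of_real A - f z) * w z" by (simp add: algebra_simps)
    then show ?thesis using nz[OF z] by (simp add: w_def)
  qed
  have "cmod (f z) \<le> 2 * A * cmod (w z) + cmod (f z) * cmod (w z)"
    using norm_triangle_ineq4[of "2 * of_real A * w z" "f z * w z"] eq A by (simp add: norm_mult)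
  also have "\<dots> = (2 * A + cmod (f z)) * cmod (w z)" by (simp add: algebra_simps)
  also have "\<dots> \<le> (2 * A + cmod (f z)) * (cmod z / R)"
    using w A by (intro mult_left_mono) auto
  finally have "cmod (f z) * (R - cmod z) \<le> 2 * A * cmod z"
    using R by (simp add: field_simps)
  then show ?thesis using z by (simp add: field_simps)
qed

text \<open>The logarithm of g, normalised to vanish at 0, has real part ln |g| < A;
  Borel-Caratheodory turns this one-sided bound into a bound for its modulus.\<close>

lemma zero_free_eq_exp:
  assumes holg: "g holomorphic_on ball 0 R" and g0: "g 0 = 1"
    and nz: "\<And>z. cmod z < R \<Longrightarrow> g z \<noteq> 0"
    and le: "\<And>z. cmod z < R \<Longrightarrow> cmod (g z) < exp A" and z: "cmod z < R"
  shows "\<exists>u. g z = exp u \<and> cmod u \<le> 2 * A * cmod z / (R - cmod z)"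
proof -
  have R: "R > 0" using z norm_ge_zero[of z] by linarith
  obtain h where h: "h holomorphic_on ball 0 R" "\<And>z. z \<in> ball 0 R \<Longrightarrow> g z = exp (h z)"
    using contractible_imp_holomorphic_log[OF holg] nz by (metis convex_ball convex_imp_contractible mem_ball_0)
  have e: "g z = exp (h z - h 0)" if "cmod z < R" for z
    using h(2)[of z] h(2)[of 0] that R g0 by (simp add: exp_diff)
  have "cmod (h z - h 0) \<le> 2 * A * cmod z / (R - cmod z)"
  proof (rule Borel_Caratheodory_0[OF _ _ _ z])
    show "(\<lambda>z. h z - h 0) holomorphic_on ball 0 R" by (intro holomorphic_intros h)
    show "Re (h z - h 0) < A" if "cmod z < R" for z
      using le[OF that] unfolding e[OF that] by (simp add: norm_exp_eq_Re)
  qed simp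
  then show ?thesis using e[OF z] by blast
qed

text \<open>An upper bound forces a lower one, because the logarithm is controlled in modulus on the
  smaller disk. There |z| <= 5/4 and the distance to the boundary is at least 3\<delta>/4, so its
  modulus is at most 10A/(3\<delta>).\<close>

lemma zero_free_lower_bound:
  assumes "g holomorphic_on ball 0 (1 + \<delta>)" "g 0 = 1" "\<And>z. cmod z < 1 + \<delta> \<Longrightarrow> g z \<noteq> 0"
    and "\<And>z. cmod z < 1 + \<delta> \<Longrightarrow> cmod (g z) < exp A"
    and \<delta>: "0 < \<delta>" "\<delta> \<le> 1" and z: "cmod z \<le> 1 + \<delta> / 4"
  shows "cmod (g z) \<ge> exp (- (4 * A / \<delta>))"
proof -
  have z': "cmod z < 1 + \<delta>" using z \<delta> by linarith
  then obtain u where u: "g z = exp u" "cmod u \<le> 2 * A * cmod z / (1 + \<delta> - cmod z)"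
    using zero_free_eq_exp[of g "1 + \<delta>" A z] assms by blast
  have A: "A > 0" using assms(4)[of 0] \<delta> assms(2) by simp
  have "2 * A * cmod z / (1 + \<delta> - cmod z) \<le> (2 * A * (5/4)) / (3 * \<delta> / 4)"
    using A z \<delta> by (intro frac_le mult_left_mono) auto
  also have "\<dots> \<le> 4 * A / \<delta>" using A \<delta> by (simp add: field_simps)
  finally have "cmod u \<le> 4 * A / \<delta>" using u by linarith
  then have "- (4 * A / \<delta>) \<le> Re u" using abs_Re_le_cmod[of u] by linarith
  then show ?thesis using u by (simp add: norm_exp_eq_Re)
qed

section \<open>Factoring out and counting the zeros of an entire function\<close>

definition root_prod :: "complex list \<Rightarrow> complex \<Rightarrow> complex" where
  "root_prod zs z = (\<Prod>w\<leftarrow>zs. 1 - z / w)"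

lemma root_prod_simps [simp]:
  "root_prod [] z = 1" "root_prod (w # zs) z = (1 - z / w) * root_prod zs z"
  "root_prod zs 0 = 1"
  by (simp_all add: root_prod_def, induction zs, auto)

lemma holomorphic_root_prod [holomorphic_intros]:
  "0 \<notin> set zs \<Longrightarrow> root_prod zs holomorphic_on S"
proof (induction zs)
  case Nil
  have "root_prod [] = (\<lambda>_. 1)" by auto
  then show ?case by simp
next
  case (Cons w zs)
  then have "(\<lambda>z. (1 - z / w) * root_prod zs z) holomorphic_on S"
    by (intro holomorphic_intros) auto
  then show ?case by simp
qed

lemma root_prod_filter:
  "root_prod zs z = root_prod (filter P zs) z * root_prod (filter (\<lambda>w. \<not> P w) zs) z"
  by (induction zs) auto

lemma root_prod_norm_ge:
  assumes "\<And>w. w \<in> set zs \<Longrightarrow> w \<noteq> 0 \<and> cmod w \<le> t" "cmod z = 3 * t"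
  shows "cmod (root_prod zs z) \<ge> 2 ^ length zs"
  using assms(1)
proof (induction zs)
  case (Cons w zs)
  have w: "w \<noteq> 0" "cmod w \<le> t" using Cons.prems by auto
  have "cmod (z / w) - 1 \<le> cmod (1 - z / w)"
    by (metis norm_minus_commute norm_one norm_triangle_ineq2)
  moreover have "cmod (z / w) \<ge> 3" using w assms(2) by (simp add: norm_divide field_simps)
  ultimately have "cmod (1 - z / w) \<ge> 2" by linarith
  then show ?case using Cons by (simp add: norm_mult mult_mono)
qed simp

text \<open>Induction on the list: dividing by the factor of its head lowers the order at that point
  by one and changes no other order. With an empty list no zero is left in the disk, since every
  zero of a function with f 0 = 1 has positive order.\<close>

lemma zero_factorization:
  assumes "f holomorphic_on UNIV" "f 0 = 1"
    and "\<And>z. count_list zs z = (if cmod z < R \<and> f z = 0 then nat (zorder f z) else 0)"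
  obtains g where "g holomorphic_on UNIV" "\<And>z. f z = root_prod zs z * g z"
    "\<And>z. cmod z < R \<Longrightarrow> g z \<noteq> 0"
  using assms
proof (induction zs arbitrary: f thesis)
  case Nil
  have "f z \<noteq> 0" if z: "cmod z < R" for z
  proof
    assume "f z = 0"
    moreover have "\<forall>\<^sub>F w in at z. f w \<noteq> 0 \<and> w \<in> UNIV"
      using Nil by (intro non_zero_neighbour_alt[of _ _ _ 0]) auto
    then have "\<exists>\<^sub>F w in at z. f w \<noteq> 0"
      by (intro eventually_frequently) (auto elim: eventually_mono)
    ultimately have "zorder f z > 0" using zorder_pos_iff[of f UNIV z] Nil.prems by auto
    then show False using Nil.prems(4)[of z] z \<open>f z = 0\<close> by simp
  qed
  then show ?case using Nil.prems by auto
next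
  case (Cons w zs)
  have "count_list (w # zs) w > 0" by simp
  then have w: "cmod w < R" "f w = 0" unfolding Cons.prems(4) by (auto split: if_splits)
  have w0: "w \<noteq> 0" using w Cons.prems(3) by auto
  \<comment> \<open>The difference quotient at \<open>w\<close>, with its removable singularity
    filled in; the factor \<open>- w\<close> makes it equal to f / (1 - z/w), so that f1 0 = 1
    again.\<close>
  define f1 where "f1 z = - w * (if z = w then deriv f w else (f z - f w) / (z - w))" for z
  have "(\<lambda>z. if z = w then deriv f w else (f z - f w) / (z - w)) holomorphic_on UNIV"
    by (rule pole_lemma) (use Cons.prems in auto)
  then have hol1: "f1 holomorphic_on UNIV"
    unfolding f1_def by (intro holomorphic_intros)
  have fac: "f z = (1 - z / w) * f1 z" for z
    using w w0 by (auto simp: f1_def field_simps)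
  have f10: "f1 0 = 1" using fac[of 0] Cons.prems(3) by simp
  have cnt: "count_list zs z = (if cmod z < R \<and> f1 z = 0 then nat (zorder f1 z) else 0)" for z
  proof -
    have ev: "\<forall>\<^sub>F w in at z. f w \<noteq> 0 \<and> w \<in> UNIV"
      using Cons.prems by (intro non_zero_neighbour_alt[of _ _ _ 0]) auto
    have "\<forall>\<^sub>F w in at z. f1 w \<noteq> 0 \<and> w \<in> UNIV"
      using hol1 f10 by (intro non_zero_neighbour_alt[of _ _ _ 0]) auto
    then have fr1: "\<exists>\<^sub>F w in at z. f1 w \<noteq> 0"
      by (intro eventually_frequently) (auto elim: eventually_mono)
    have an: "f1 analytic_on {z}" using hol1 analytic_at by blast
    have an2: "(\<lambda>z. 1 - z / w) analytic_on {z}" using w0 by (intro analytic_intros) auto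
    have ord: "zorder f z = zorder (\<lambda>z. 1 - z / w) z + zorder f1 z"
      unfolding fac[abs_def]
      by (rule zorder_times_analytic[OF an2 an])
         (use ev in \<open>auto elim!: eventually_mono simp: fac[symmetric]\<close>)
    have nn: "zorder f1 z \<ge> 0" "zorder f1 z > 0 \<longleftrightarrow> f1 z = 0"
      using zorder_ge_0[OF an fr1] zorder_pos_iff'[OF an fr1] by auto
    show ?thesis
    proof (cases "z = w")
      case True
      have "zorder (\<lambda>z. 1 - z / w) z = 1"
        by (rule zorder_eqI[of UNIV _ "\<lambda>_. - 1 / w"]) (use True w0 in \<open>auto simp: field_simps\<close>)
      then have "zorder f w = 1 + zorder f1 w" using ord True by simp
      then show ?thesis using Cons.prems(4)[of w] w True nn by (auto split: if_splits)
    next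
      case False
      have "zorder (\<lambda>z. 1 - z / w) z = 0"
        by (rule zorder_eq_0I[OF an2]) (use False w0 in \<open>auto simp: field_simps\<close>)
      then show ?thesis using Cons.prems(4)[of z] False w0 ord fac[of z] by (auto simp: field_simps)
    qed
  qed
  obtain g where g: "g holomorphic_on UNIV" "\<And>z. f1 z = root_prod zs z * g z"
    "\<And>z. cmod z < R \<Longrightarrow> g z \<noteq> 0"
    using Cons.IH[OF _ hol1 f10 cnt] by blast
  show ?case using Cons.prems(1)[OF g(1) _ g(3)] fac g(2) by simp
qed

text \<open>A Jensen-type count. Only the zeros with |w| < t are divided out, each gaining a factor
  2 on |z| = 3t; the maximum principle carries the bound to 0, where the quotient \<open>g'\<close>
  is 1. If all listed zeros satisfy |w| < t, then \<open>g'\<close> agrees with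
  \<open>g\<close>.\<close>

lemma count_roots_le:
  assumes holg: "g holomorphic_on UNIV" and f: "\<And>z. f z = root_prod zs z * g z" and f0: "f 0 = 1"
    and zs: "0 \<notin> set zs" and t: "t > 0" and le: "\<And>z. cmod z = 3 * t \<Longrightarrow> cmod (f z) \<le> exp A"
  shows "length (filter (\<lambda>w. cmod w < t) zs) * ln 2 \<le> A"
    and "(\<And>w. w \<in> set zs \<Longrightarrow> cmod w < t) \<Longrightarrow> cmod z \<le> 3 * t \<Longrightarrow> cmod (g z) \<le> exp A"
proof -
  define us where "us = filter (\<lambda>w. cmod w < t) zs"
  define g' where "g' z = root_prod (filter (\<lambda>w. \<not> cmod w < t) zs) z * g z" for z
  have holg': "g' holomorphic_on UNIV"
    unfolding g'_def using zs by (intro holomorphic_intros holg) auto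
  have f': "f z = root_prod us z * g' z" for z
    unfolding g'_def us_def f using root_prod_filter[of zs z "\<lambda>w. cmod w < t"] by simp
  have le': "cmod (g' z) \<le> exp A / 2 ^ length us" if "cmod z \<le> 3 * t" for z
  proof (rule maximum_modulus_frontier[of g' "cball 0 (3 * t)"])
    fix x :: complex assume "x \<in> frontier (cball 0 (3 * t))"
    then have x: "cmod x = 3 * t" using t by simp
    have "2 ^ length us \<le> cmod (root_prod us x)"
      by (rule root_prod_norm_ge[OF _ x]) (use zs in \<open>auto simp: us_def\<close>)
    then have "2 ^ length us * cmod (g' x) \<le> cmod (f x)"
      unfolding f' norm_mult by (intro mult_right_mono) auto
    also have "\<dots> \<le> exp A" by (rule le[OF x])
    finally show "cmod (g' x) \<le> exp A / 2 ^ length us" by (simp add: field_simps)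
  qed (use that holg' in \<open>auto intro: holomorphic_on_subset holomorphic_on_imp_continuous_on\<close>)
  have "g' 0 = 1" using f'[of 0] f0 by simp
  then have "1 \<le> exp A / 2 ^ length us" using le'[of 0] t by simp
  then have "(2::real) ^ length us \<le> exp A" by (simp add: field_simps)
  then have "ln ((2::real) ^ length us) \<le> ln (exp A)" by (subst ln_le_cancel_iff) auto
  then show "length (filter (\<lambda>w. cmod w < t) zs) * ln 2 \<le> A"
    by (simp add: ln_realpow us_def)
  assume all: "\<And>w. w \<in> set zs \<Longrightarrow> cmod w < t" and z: "cmod z \<le> 3 * t"
  have "g' z = g z" using all unfolding g'_def by (subst filter_False) auto
  moreover have "exp A / 2 ^ length us \<le> exp A" by (simp add: divide_le_eq_1 field_simps)
  ultimately show "cmod (g z) \<le> exp A" using le'[OF z] by simp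
qed

text \<open>Dyadic summation: if k is least with |w| < 2^k, then 1/|w|^2 <= 4/4^k. After exchanging
  the sums each k contributes at most C 2^k / 4^k, a geometric series.\<close>

lemma sum_inverse_square_le:
  fixes C :: real
  assumes ge1: "\<And>w. w \<in> set zs \<Longrightarrow> cmod w \<ge> 1"
    and cnt: "\<And>t. t \<ge> 1 \<Longrightarrow> length (filter (\<lambda>w. cmod w < t) zs) \<le> C * t"
  shows "(\<Sum>w\<leftarrow>zs. 1 / (cmod w)\<^sup>2) \<le> 8 * C"
proof -
  have "\<exists>K. \<forall>w\<in>set zs. cmod w < 2 ^ K"
  proof -
    obtain K where "Max (cmod ` set (0 # zs)) < 2 ^ K"
      using real_arch_pow[of 2 "Max (cmod ` set (0 # zs))"] by auto
    then have "\<forall>w\<in>set (0 # zs). cmod w < 2 ^ K"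
      by (subst (asm) Max_less_iff) auto
    then show ?thesis by auto
  qed
  then obtain K where K: "\<forall>w\<in>set zs. cmod w < 2 ^ K" by blast
  have pt: "1 / (cmod w)\<^sup>2 \<le> 4 * (\<Sum>k\<le>K. if cmod w < 2 ^ k then 1 / 4 ^ k else 0)"
    if w: "w \<in> set zs" for w
  proof -
    define k where "k = (LEAST k. cmod w < 2 ^ k)"
    have k: "cmod w < 2 ^ k" unfolding k_def by (rule LeastI[of _ K]) (use K w in auto)
    have kK: "k \<le> K" unfolding k_def by (rule Least_le) (use K w in auto)
    \<comment> \<open>The value k = 0 is excluded by |w| >= 1, so minimality can be used at k -
      1.\<close>
    obtain m where m: "k = Suc m" using k ge1[OF w] by (cases k) auto
    have "\<not> cmod w < 2 ^ m" using not_less_Least[of m "\<lambda>k. cmod w < 2 ^ k"] m by (auto simp: k_def)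
    then have "(2 ^ m)\<^sup>2 \<le> (cmod w)\<^sup>2" by (intro power_mono) auto
    then have "(4::real) ^ m \<le> (cmod w)\<^sup>2" by (simp add: power_even_eq[symmetric] power_mult)
    then have "1 / (cmod w)\<^sup>2 \<le> 1 / 4 ^ m" by (intro frac_le) auto
    also have "\<dots> = 4 * (1 / 4 ^ k)" by (simp add: m)
    also have "1 / 4 ^ k = (\<Sum>k\<in>{k}. if cmod w < 2 ^ k then 1 / 4 ^ k else (0::real))" using k by simp
    also have "\<dots> \<le> (\<Sum>k\<le>K. if cmod w < 2 ^ k then 1 / 4 ^ k else 0)"
      by (rule sum_mono2) (use kK in auto)
    finally show ?thesis by simp
  qed
  have "(\<Sum>w\<leftarrow>zs. 1 / (cmod w)\<^sup>2) \<le> (\<Sum>w\<leftarrow>zs. 4 * (\<Sum>k\<le>K. if cmod w < 2 ^ k then 1 / 4 ^ k else 0))"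
    by (rule sum_list_mono) (rule pt)
  also have "\<dots> = 4 * (\<Sum>k\<le>K. \<Sum>w\<leftarrow>zs. if cmod w < 2 ^ k then 1 / 4 ^ k else 0)"
    by (induction zs) (simp_all add: sum.distrib sum_distrib_left algebra_simps)
  also have "(\<Sum>k\<le>K. \<Sum>w\<leftarrow>zs. if cmod w < 2 ^ k then 1 / 4 ^ k else 0) \<le> (\<Sum>k\<le>K. C * (1 / 2) ^ k)"
  proof (rule sum_mono)
    fix k
    have "(\<Sum>w\<leftarrow>zs. if cmod w < 2 ^ k then 1 / 4 ^ k else 0) = length (filter (\<lambda>w. cmod w < 2 ^ k) zs) / (4::real) ^ k"
      by (induction zs) (simp_all add: add_divide_distrib)
    also have "\<dots> \<le> C * 2 ^ k / 4 ^ k" by (intro divide_right_mono cnt) auto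
    also have "\<dots> = C * 2 ^ k / (2 ^ k * 2 ^ k)" by (simp flip: power_mult_distrib)
    also have "\<dots> = C * (1 / 2) ^ k" by (simp add: power_one_over)
    finally show "(\<Sum>w\<leftarrow>zs. if cmod w < 2 ^ k then 1 / 4 ^ k else 0) \<le> C * (1 / 2) ^ k" .
  qed
  also have "\<dots> \<le> C * 2"
  proof -
    have "0 \<le> C" using cnt[of 1] by (metis mult.right_neutral of_nat_0_le_iff order.refl order_trans)
    moreover have "(\<Sum>k\<le>K. (1 / 2 :: real) ^ k) \<le> 2"
      using sum_le_suminf[of "\<lambda>k. (1 / 2 :: real) ^ k" "{..K}"] suminf_geometric[of "1/2::real"] by simp
    ultimately show ?thesis by (simp add: sum_distrib_left[symmetric] mult_left_mono)
  qed
  finally show ?thesis by simp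
qed

section \<open>Comparing two entire functions with nearby zeros\<close>

lemma one_plus_mult_bound:
  fixes a b :: complex
  assumes "cmod (a - 1) \<le> exp s - 1" "cmod (b - 1) \<le> exp t - 1"
  shows "cmod (a * b - 1) \<le> exp (s + t) - 1"
proof -
  \<comment> \<open>Since (1 + x)(1 + y) - 1 = xy + x + y, bounds of the form exp s - 1 are stable
    under products and the exponents simply add.\<close>
  have "cmod (a * b - 1) = cmod ((a - 1) * (b - 1) + (a - 1) + (b - 1))" by (simp add: algebra_simps)
  also have "\<dots> \<le> cmod (a - 1) * cmod (b - 1) + cmod (a - 1) + cmod (b - 1)"
    by (metis (no_types) add_mono_thms_linordered_semiring(3) norm_mult norm_triangle_ineq order_trans)
  also have "\<dots> \<le> (exp s - 1) * (exp t - 1) + (exp s - 1) + (exp t - 1)"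
    using assms by (intro add_mono mult_mono order_trans[OF norm_ge_zero[of "a - 1"] assms(1)]) auto
  finally show ?thesis by (simp add: exp_add algebra_simps)
qed

lemma norm_exp_minus_one_le: "cmod (exp u - 1) \<le> exp (cmod u) - 1"
proof -
  have 1: "(\<lambda>n. u ^ Suc n /\<^sub>R fact (Suc n)) sums (exp u - 1)"
    using exp_converges[of u] by (subst sums_Suc_iff) simp
  have 2: "(\<lambda>n. cmod u ^ Suc n /\<^sub>R fact (Suc n)) sums (exp (cmod u) - 1)"
    using exp_converges[of "cmod u"] by (subst sums_Suc_iff) simp
  have "cmod (\<Sum>n. u ^ Suc n /\<^sub>R fact (Suc n)) \<le> (\<Sum>n. cmod u ^ Suc n /\<^sub>R fact (Suc n))"
    by (rule norm_suminf_le) (use 2 in \<open>auto simp: norm_mult norm_power sums_iff\<close>)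
  then show ?thesis using 1 2 by (simp add: sums_iff)
qed

text \<open>One pair contributes x (z - w) / (z (w - x)), of order \<epsilon> / (|z| |w|). The mean
  inequality splits 1 / (|z| |w|) into inverse squares, so the zeros enter only through these sums
  and not through their number.\<close>

lemma root_prod_ratio:
  assumes "list_all2 (\<lambda>z w. cmod (z - w) < \<epsilon>) zs ws"
    and \<delta>: "0 < \<delta>" "\<delta> \<le> 1" and x: "cmod x \<le> 1 + \<delta> / 4"
    and "\<And>z. z \<in> set zs \<union> set ws \<Longrightarrow> cmod z \<ge> 1 + \<delta>"
  shows "cmod (root_prod zs x / root_prod ws x - 1) \<le>
    exp (2 * \<epsilon> / \<delta> * ((\<Sum>z\<leftarrow>zs. 1 / (cmod z)\<^sup>2) + (\<Sum>w\<leftarrow>ws. 1 / (cmod w)\<^sup>2))) - 1"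
  using assms(1,5)
proof (induction rule: list_all2_induct)
  case (Cons z zs w ws)
  have zw: "cmod z \<ge> 1 + \<delta>" "cmod w \<ge> 1 + \<delta>" using Cons.prems by auto
  then have nz: "z \<noteq> 0" "w \<noteq> 0" "w \<noteq> x" using \<delta> x by auto
  have eps: "\<epsilon> > 0" using Cons.hyps(1) norm_ge_zero[of "z - w"] by linarith
  have "(1 - x / z) / (1 - x / w) - 1 = x * (z - w) / (z * (w - x))"
    using nz by (simp add: field_simps)
  then have "cmod ((1 - x / z) / (1 - x / w) - 1) = cmod x * cmod (z - w) / (cmod z * cmod (w - x))"
    by (simp add: norm_mult norm_divide)
  also have "\<dots> \<le> (5 / 4 * \<epsilon>) / (cmod z * (cmod w * (3 * \<delta> / 8)))"
  proof (rule frac_le)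
    show "cmod x * cmod (z - w) \<le> 5 / 4 * \<epsilon>"
      using x \<delta> Cons.hyps(1) by (intro mult_mono) auto
    \<comment> \<open>With 3/8 this inequality amounts to \<delta>^2 <= \<delta>. It gives |x| <=
      |w| (1 - 3\<delta>/8), so |w - x| keeps a fixed share of |w|, which supplies the factor
      1/|w|.\<close>
    have "1 + \<delta> / 4 \<le> (1 + \<delta>) * (1 - 3 * \<delta> / 8)"
    proof -
      have "\<delta> * \<delta> \<le> \<delta>" using \<delta> by (simp add: mult_left_le)
      moreover have "(1 + \<delta>) * (1 - 3 * \<delta> / 8) = 1 + 5 * \<delta> / 8 - 3 * (\<delta> * \<delta>) / 8"
        by (simp add: field_simps)
      ultimately show ?thesis by linarith
    qed
    also have "\<dots> \<le> cmod w * (1 - 3 * \<delta> / 8)" using zw \<delta> by (intro mult_right_mono) auto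
    finally have "cmod w * (3 * \<delta> / 8) \<le> cmod w - cmod x" using x by (simp add: algebra_simps)
    also have "\<dots> \<le> cmod (w - x)" by (rule norm_triangle_ineq2)
    finally show "cmod z * (cmod w * (3 * \<delta> / 8)) \<le> cmod z * cmod (w - x)"
      by (rule mult_left_mono) simp
  qed (use nz \<delta> eps in auto)
  also have "\<dots> = 10 / 3 * \<epsilon> / \<delta> * (1 / cmod z * (1 / cmod w))" by (simp add: field_simps)
  also have "\<dots> \<le> 4 * \<epsilon> / \<delta> * (1 / cmod z * (1 / cmod w))"
    using eps \<delta> by (intro mult_right_mono divide_right_mono) auto
  also have "\<dots> \<le> 4 * \<epsilon> / \<delta> * ((1 / (cmod z)\<^sup>2 + 1 / (cmod w)\<^sup>2) / 2)"
  proof (rule mult_left_mono)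
    have "0 \<le> (1 / cmod z - 1 / cmod w)\<^sup>2" by simp
    then show "1 / cmod z * (1 / cmod w) \<le> (1 / (cmod z)\<^sup>2 + 1 / (cmod w)\<^sup>2) / 2"
      by (simp add: power2_diff power_divide)
  qed (use eps \<delta> in auto)
  also have "\<dots> = 2 * \<epsilon> / \<delta> * (1 / (cmod z)\<^sup>2 + 1 / (cmod w)\<^sup>2)" by simp
  also have "\<dots> \<le> exp \<dots> - 1" using exp_ge_add_one_self by (simp add: le_diff_eq add.commute)
  finally have 1: "cmod ((1 - x / z) / (1 - x / w) - 1) \<le> exp (2 * \<epsilon> / \<delta> * (1 / (cmod z)\<^sup>2 + 1 / (cmod w)\<^sup>2)) - 1" .
  have 2: "root_prod (z # zs) x / root_prod (w # ws) x
      = ((1 - x / z) / (1 - x / w)) * (root_prod zs x / root_prod ws x)"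
    by simp
  have 3: "2 * \<epsilon> / \<delta> * (1 / (cmod z)\<^sup>2 + 1 / (cmod w)\<^sup>2)
     + 2 * \<epsilon> / \<delta> * ((\<Sum>z\<leftarrow>zs. 1 / (cmod z)\<^sup>2) + (\<Sum>w\<leftarrow>ws. 1 / (cmod w)\<^sup>2))
     = 2 * \<epsilon> / \<delta> * ((\<Sum>z\<leftarrow>z # zs. 1 / (cmod z)\<^sup>2) + (\<Sum>w\<leftarrow>w # ws. 1 / (cmod w)\<^sup>2))"
    by (simp add: algebra_simps add_divide_distrib)
  show ?case unfolding 2 3[symmetric]
    by (rule one_plus_mult_bound[OF 1 Cons.IH]) (use Cons.prems in auto)
qed simp

text \<open>The quotient splits into that of the root products and that of the zero-free remainders.
  Linear growth of \<open>G (3 * t)\<close> bounds each inverse-square sum by 16 C, whence 64 C /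
  \<delta>. Each remainder is at most exp (G (3R)) on |z| < R, so its logarithm at x is at most 4 (G
  (3R) + 1) / R.\<close>

lemma entire_ratio_bound:
  fixes G :: "real \<Rightarrow> real"
  assumes hol: "f holomorphic_on UNIV" "f' holomorphic_on UNIV" and f0: "f 0 = 1" "f' 0 = 1"
    and G: "\<And>z t. t \<ge> 1 \<Longrightarrow> cmod z \<le> t \<Longrightarrow> cmod (f z) \<le> exp (G t)"
           "\<And>z t. t \<ge> 1 \<Longrightarrow> cmod z \<le> t \<Longrightarrow> cmod (f' z) \<le> exp (G t)"
    and C: "\<And>t. t \<ge> 1 \<Longrightarrow> G (3 * t) \<le> C * t"
    and zs: "\<And>z. count_list zs z = (if cmod z < R \<and> f z = 0 then nat (zorder f z) else 0)"
    and ws: "\<And>z. count_list ws z = (if cmod z < R \<and> f' z = 0 then nat (zorder f' z) else 0)"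
    and zw: "list_all2 (\<lambda>z w. cmod (z - w) < \<epsilon>) zs ws" and \<epsilon>: "\<epsilon> > 0"
    and nz: "\<And>z. cmod z < 1 + \<delta> \<Longrightarrow> f z \<noteq> 0" "\<And>z. cmod z < 1 + \<delta> \<Longrightarrow> f' z \<noteq> 0"
    and \<delta>: "0 < \<delta>" "\<delta> \<le> 1" and R: "R \<ge> 4" and x: "cmod x \<le> 1 + \<delta> / 4"
  shows "cmod (f x / f' x - 1) \<le> exp (64 * C / \<delta> * \<epsilon> + 8 * (G (3 * R) + 1) / R) - 1"
proof -
  obtain g where g: "g holomorphic_on UNIV" "\<And>z. f z = root_prod zs z * g z"
    "\<And>z. cmod z < R \<Longrightarrow> g z \<noteq> 0"
    using zero_factorization[OF hol(1) f0(1) zs] by blast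
  obtain g' where g': "g' holomorphic_on UNIV" "\<And>z. f' z = root_prod ws z * g' z"
    "\<And>z. cmod z < R \<Longrightarrow> g' z \<noteq> 0"
    using zero_factorization[OF hol(2) f0(2) ws] by blast
  have zR: "cmod z < R \<and> f z = 0" if "z \<in> set zs" for z
    using zs[of z] that count_list_0_iff[of zs z] by (auto split: if_splits)
  have wR: "cmod w < R \<and> f' w = 0" if "w \<in> set ws" for w
    using ws[of w] that count_list_0_iff[of ws w] by (auto split: if_splits)
  have zge: "cmod z \<ge> 1 + \<delta>" if "z \<in> set zs \<union> set ws" for z
    using that nz zR wR by (meson UnE not_le)
  have z0: "0 \<notin> set zs" "0 \<notin> set ws" using zR wR f0 by auto
  have key: "(\<Sum>w\<leftarrow>us. 1 / (cmod w)\<^sup>2) \<le> 16 * C \<and>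
      (\<exists>u. h x = exp u \<and> cmod u \<le> 4 * (G (3 * R) + 1) / R)"
    if hh: "k 0 = 1" "\<And>z t. t \<ge> 1 \<Longrightarrow> cmod z \<le> t \<Longrightarrow> cmod (k z) \<le> exp (G t)"
      "h holomorphic_on UNIV" "\<And>z. k z = root_prod us z * h z" "\<And>z. cmod z < R \<Longrightarrow> h z \<noteq> 0"
      "0 \<notin> set us" "\<And>z. z \<in> set us \<Longrightarrow> cmod z < R \<and> 1 + \<delta> \<le> cmod z" for k h us
  proof
    have ln2: "ln (2::real) \<ge> 1 / 2" using ln_diff_le[of 1 2] by simp
    have cnt: "length (filter (\<lambda>w. cmod w < t) us) \<le> (2 * C) * t" if t: "t \<ge> 1" for t
    proof -
      have "length (filter (\<lambda>w. cmod w < t) us) * ln 2 \<le> G (3 * t)"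
        by (rule count_roots_le(1)[OF hh(3,4,1,6)]) (use t hh(2) in auto)
      moreover have "length (filter (\<lambda>w. cmod w < t) us) * (1 / 2) \<le> length (filter (\<lambda>w. cmod w < t) us) * ln (2::real)"
        by (intro mult_left_mono ln2) auto
      ultimately show ?thesis using C[OF t] by linarith
    qed
    have "(\<Sum>w\<leftarrow>us. 1 / (cmod w)\<^sup>2) \<le> 8 * (2 * C)"
      by (rule sum_inverse_square_le[OF _ cnt]) (use hh(7) \<delta> in fastforce)
    then show "(\<Sum>w\<leftarrow>us. 1 / (cmod w)\<^sup>2) \<le> 16 * C" by simp
    have h0: "h 0 = 1" using hh(1) hh(4)[of 0] by simp
    have hle: "cmod (h z) < exp (G (3 * R) + 1)" if "cmod z < R" for z
    proof -
      have "cmod (h z) \<le> exp (G (3 * R))"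
        by (rule count_roots_le(2)[OF hh(3,4,1,6), of R]) (use R hh(2,7) that in auto)
      then show ?thesis by (rule le_less_trans) simp
    qed
    have xR: "cmod x < R" using x \<delta> R by linarith
    obtain u where u: "h x = exp u" "cmod u \<le> 2 * (G (3 * R) + 1) * cmod x / (R - cmod x)"
      using zero_free_eq_exp[OF holomorphic_on_subset[OF hh(3) subset_UNIV] h0 hh(5) hle xR] by blast
    have G1: "G (3 * R) + 1 > 0" using hle[of 0] R by (simp add: h0)
    have "cmod x / (R - cmod x) \<le> (5 / 4) / (R - 5 / 4)" using x \<delta> R by (intro frac_le) auto
    also have "\<dots> \<le> 2 / R" using R by (simp add: field_simps)
    finally have "2 * (G (3 * R) + 1) * (cmod x / (R - cmod x)) \<le> 2 * (G (3 * R) + 1) * (2 / R)"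
      using G1 by (intro mult_left_mono) auto
    then show "\<exists>u. h x = exp u \<and> cmod u \<le> 4 * (G (3 * R) + 1) / R" using u by auto
  qed
  obtain u where u: "(\<Sum>w\<leftarrow>zs. 1 / (cmod w)\<^sup>2) \<le> 16 * C" "g x = exp u" "cmod u \<le> 4 * (G (3 * R) + 1) / R"
    using key[OF f0(1) G(1) g z0(1)] zR zge by auto
  obtain v where v: "(\<Sum>w\<leftarrow>ws. 1 / (cmod w)\<^sup>2) \<le> 16 * C" "g' x = exp v" "cmod v \<le> 4 * (G (3 * R) + 1) / R"
    using key[OF f0(2) G(2) g' z0(2)] wR zge by auto
  define s where "s = 2 * \<epsilon> / \<delta> * ((\<Sum>z\<leftarrow>zs. 1 / (cmod z)\<^sup>2) + (\<Sum>w\<leftarrow>ws. 1 / (cmod w)\<^sup>2))"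
  have eq: "f x / f' x = (root_prod zs x / root_prod ws x) * exp (u - v)"
    unfolding g(2) g'(2) u v by (simp add: exp_diff)
  have "cmod (f x / f' x - 1) \<le> exp (s + cmod (u - v)) - 1"
    unfolding eq s_def
    by (rule one_plus_mult_bound[OF root_prod_ratio[OF zw \<delta> x zge] norm_exp_minus_one_le])
  also have "\<dots> \<le> exp (64 * C / \<delta> * \<epsilon> + 8 * (G (3 * R) + 1) / R) - 1"
  proof -
    have "s \<le> 2 * \<epsilon> / \<delta> * (16 * C + 16 * C)"
      unfolding s_def by (rule mult_left_mono) (use u v \<epsilon> \<delta> in auto)
    moreover have "cmod (u - v) \<le> cmod u + cmod v" by (rule norm_triangle_ineq4)
    ultimately have "s + cmod (u - v) \<le> 2 * \<epsilon> / \<delta> * (16 * C + 16 * C) + (4 * (G (3 * R) + 1) / R + 4 * (G (3 * R) + 1) / R)"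
      using u(3) v(3) by linarith
    also have "\<dots> = 64 * C / \<delta> * \<epsilon> + 8 * (G (3 * R) + 1) / R" by (simp add: field_simps)
    finally show ?thesis by simp
  qed
  finally show ?thesis .
qed

section \<open>Boundary values and reflection in the unit circle\<close>

lemma exists_Re_nonpos:
  assumes holG: "G holomorphic_on ball 0 R" and R: "R > 1" and G0: "G 0 = 0"
  shows "\<exists>z. cmod z = 1 \<and> Re (G z) \<le> 0"
proof (rule ccontr)
  assume "\<not> ?thesis"
  then have pos: "Re (G z) > 0" if "cmod z = 1" for z using that by (meson not_le)
  have sub: "cball 0 1 \<subseteq> ball (0::complex) R" using R by auto
  then have cont: "continuous_on (cball 0 1) G"
    using holG holomorphic_on_imp_continuous_on continuous_on_subset by blast
  have "compact (sphere (0::complex) 1)" "sphere (0::complex) 1 \<noteq> {}" by auto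
  moreover have "continuous_on (sphere 0 1) (\<lambda>z. Re (G z))"
    by (intro continuous_intros continuous_on_subset[OF cont]) auto
  ultimately obtain w where w: "w \<in> sphere 0 1" "\<And>z. z \<in> sphere 0 1 \<Longrightarrow> Re (G w) \<le> Re (G z)"
    using continuous_attains_inf[of "sphere 0 1" "\<lambda>z. Re (G z)"] by blast
  \<comment> \<open>By the maximum principle for Re (- G), the minimum of Re G on the circle is also
    a lower bound at 0, where G vanishes; so it cannot be positive.\<close>
  have "Re (- G 0) \<le> - Re (G w)"
  proof (rule maximum_real_frontier[of "\<lambda>z. - G z" "cball 0 1"])
    show "(\<lambda>z. - G z) holomorphic_on interior (cball 0 1)"
      by (intro holomorphic_on_minus holomorphic_on_subset[OF holG]) (use R in auto)
    show "continuous_on (closure (cball 0 1)) (\<lambda>z. - G z)"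
      using cont by (simp add: continuous_on_minus)
    show "Re (- G z) \<le> - Re (G w)" if "z \<in> frontier (cball 0 1)" for z
      using w(2)[of z] that by simp
  qed auto
  then show False using pos[of w] w(1) G0 by simp
qed

text \<open>
  Up to an error \<open>H\<close>, the modulus of \<open>G\<close> on the circle of radius \<open>r\<close> is bounded by its values on the
  circle of radius \<open>1 / r\<close>, which by the Schwarz lemma are at most \<open>r\<^sup>-\<^sup>2\<close> times the supremum of \<open>\<bar>G\<bar>\<close>.
\<close>

lemma bound_by_reflection:
  assumes holG: "G holomorphic_on ball 0 R" and r: "1 < r" "r < R" and G0: "G 0 = 0"
    and H: "\<And>z. cmod z = r \<Longrightarrow> cmod (G z + cnj (G (1 / cnj z))) \<le> H"
    and z: "cmod z \<le> r"
  shows "cmod (G z) \<le> cmod z * (H * r / (r\<^sup>2 - 1))"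
proof -
  have sub: "cball 0 r \<subseteq> ball (0::complex) R" using r by auto
  then have cont: "continuous_on (cball 0 r) G"
    using holG holomorphic_on_imp_continuous_on continuous_on_subset by blast
  have "compact (cball (0::complex) r)" "cball (0::complex) r \<noteq> {}" using r by auto
  moreover have "continuous_on (cball 0 r) (\<lambda>z. cmod (G z))"
    by (intro continuous_intros cont)
  ultimately obtain w where w: "cmod w \<le> r" "\<And>z. cmod z \<le> r \<Longrightarrow> cmod (G z) \<le> cmod (G w)"
    using continuous_attains_sup[of "cball 0 r" "\<lambda>z. cmod (G z)"] by auto
  define M where "M = cmod (G w)"
  have holr: "G holomorphic_on ball 0 r" using holG r by (auto intro: holomorphic_on_subset)
  have schwarz: "cmod (G z) \<le> M * cmod z / r" if "cmod z < r" for z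
    by (rule Schwarz_scaled[OF holr G0 _ _ that]) (use r w in \<open>auto simp: M_def\<close>)
  have "cmod (G w) \<le> H + M / r\<^sup>2"
  proof (rule maximum_modulus_frontier[of G "cball 0 r"])
    fix z :: complex assume "z \<in> frontier (cball 0 r)"
    then have z: "cmod z = r" using r by simp
    have "1 / r < 1" using r by simp
    then have "1 / r < r" using r by linarith
    then have "cmod (G (1 / cnj z)) \<le> M * cmod (1 / cnj z) / r"
      by (intro schwarz) (use z in \<open>simp add: norm_divide\<close>)
    then have "cmod (cnj (G (1 / cnj z))) \<le> M / r\<^sup>2"
      using z by (simp add: norm_divide power2_eq_square)
    moreover have "cmod (G z) \<le> cmod (G z + cnj (G (1 / cnj z))) + cmod (cnj (G (1 / cnj z)))"
      by (metis add_diff_cancel_right' norm_triangle_ineq4)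
    ultimately show "cmod (G z) \<le> H + M / r\<^sup>2" using H[OF z] by linarith
  qed (use w cont holr in auto)
  \<comment> \<open>The term M / r^2 is absorbed into the left side, as r^2 > 1.\<close>
  then have "M \<le> H + M / r\<^sup>2" by (simp add: M_def)
  then have "M * r\<^sup>2 \<le> (H + M / r\<^sup>2) * r\<^sup>2" by (rule mult_right_mono) simp
  also have "\<dots> = H * r\<^sup>2 + M" using r by (simp add: distrib_right)
  finally have le: "M * (r\<^sup>2 - 1) \<le> H * r\<^sup>2" by (simp add: algebra_simps)
  obtain d where d: "d = r\<^sup>2 - 1" by blast
  have d0: "d > 0" using r one_less_power[of r 2] d by simp
  have M: "M \<le> H * r\<^sup>2 / d" using le d0 d by (simp add: pos_le_divide_eq)
  \<comment> \<open>Schwarz once more restores the factor |z|; on |z| = r the claim is the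
    maximality of \<open>M\<close>.\<close>
  have "cmod (G z) \<le> M * cmod z / r"
  proof (cases "cmod z < r")
    case False
    then show ?thesis using w(2)[OF z] z r by (simp add: M_def)
  qed (rule schwarz)
  also have "\<dots> \<le> (H * r\<^sup>2 / d) * cmod z / r"
    using M r by (intro divide_right_mono mult_right_mono) auto
  also have "\<dots> = cmod z * (H * r / d)" using r d0 by (simp add: field_simps power2_eq_square)
  finally show ?thesis unfolding d .
qed

subsection \<open>Caratheodory functions\<close>

text \<open>\<open>A'\<close> and \<open>B'\<close> stand for the conjugates of A and B at y = 1 /
  cnj z, so \<open>B' / z\<close> is the conjugate of y B(y). The mixed terms cancel and leave A A'
  - B B', which the recursion makes constant in z.\<close>

lemma caratheodory_reflection:
  fixes A B A' B' z :: complex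
  assumes "z \<noteq> 0" "A + z * B \<noteq> 0" "A' + B' / z \<noteq> 0"
  shows "(A - z * B) / (A + z * B) + (A' - B' / z) / (A' + B' / z)
    = 2 * (A * A' - B * B') / ((A + z * B) * (A' + B' / z))"
proof -
  have "(A - z * B) * (A' + B' / z) + (A' - B' / z) * (A + z * B) = 2 * (A * A' - B * B')"
    using assms(1) by (simp add: field_simps)
  then show ?thesis using assms(2,3) by (simp add: add_frac_eq)
qed

text \<open>
  The size of \<open>\<kappa>\<close> is not determined by \<open>a + z b\<close> directly, but only through the normalisation of the
  Caratheodory functions at \<open>0\<close>: the real part of their difference changes sign on the unit circle,
  which forces \<open>\<kappa>' / \<kappa>\<close> to be close to \<open>1\<close>.
\<close>

lemma caratheodory_stability:
  fixes a b a' b' :: "complex \<Rightarrow> complex" and \<kappa> \<kappa>' \<theta> B \<delta> :: real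
  defines "\<phi> \<equiv> \<lambda>z. a z + z * b z" and "\<phi>' \<equiv> \<lambda>z. a' z + z * b' z"
  assumes hol: "a holomorphic_on UNIV" "b holomorphic_on UNIV" "a' holomorphic_on UNIV" "b' holomorphic_on UNIV"
    and a0: "a 0 = 1" "a' 0 = 1"
    and \<kappa>: "0 < \<kappa>" "\<kappa> \<le> 1" "0 < \<kappa>'"
    and id: "\<And>z. z \<noteq> 0 \<Longrightarrow> a z * cnj (a (1 / cnj z)) - b z * cnj (b (1 / cnj z)) = of_real \<kappa>"
       "\<And>z. z \<noteq> 0 \<Longrightarrow> a' z * cnj (a' (1 / cnj z)) - b' z * cnj (b' (1 / cnj z)) = of_real \<kappa>'"
    and nz: "\<And>z. cmod z < 1 + \<delta> \<Longrightarrow> \<phi> z \<noteq> 0" "\<And>z. cmod z < 1 + \<delta> \<Longrightarrow> \<phi>' z \<noteq> 0"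
    and lb: "\<And>z. cmod z \<le> 1 + \<delta> / 4 \<Longrightarrow> exp (- B) \<le> cmod (\<phi> z)"
    and near: "\<And>z. cmod z \<le> 1 + \<delta> / 4 \<Longrightarrow> cmod (\<phi> z / \<phi>' z - 1) \<le> \<theta>"
    and \<theta>: "\<theta> \<le> 1 / 2" and \<delta>: "0 < \<delta>" "\<delta> \<le> 1" and z: "cmod z \<le> 1"
  shows "cmod ((a z - z * b z) / \<phi> z - (a' z - z * b' z) / \<phi>' z) \<le> cmod z * (120 * exp (2 * B) / \<delta> * \<theta>)"
proof -
  define G where "G z = (a z - z * b z) / \<phi> z - (a' z - z * b' z) / \<phi>' z" for z
  define r where "r = 1 + \<delta> / 4"
  define l where "l = \<kappa>' / \<kappa>"
  define q where "q z = \<phi> z / \<phi>' z" for z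
  have \<theta>0: "\<theta> \<ge> 0" using near[of 0] \<delta> by (auto intro: order_trans[OF norm_ge_zero])
  have r: "1 < r" "r < 1 + \<delta>" "r \<le> 5 / 4" using \<delta> by (auto simp: r_def)
  have l: "l > 0" using \<kappa> by (simp add: l_def)
  have hol\<phi>: "\<phi> holomorphic_on UNIV" "\<phi>' holomorphic_on UNIV"
    unfolding \<phi>_def \<phi>'_def by (intro holomorphic_intros hol)+
  have holG: "G holomorphic_on ball 0 (1 + \<delta>)"
    unfolding G_def using nz
    by (intro holomorphic_intros holomorphic_on_subset[OF hol(1)] holomorphic_on_subset[OF hol(2)]
        holomorphic_on_subset[OF hol(3)] holomorphic_on_subset[OF hol(4)]
        holomorphic_on_subset[OF hol\<phi>(1)] holomorphic_on_subset[OF hol\<phi>(2)]) auto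
  have G0: "G 0 = 0" by (simp add: G_def \<phi>_def \<phi>'_def a0)
  \<comment> \<open>The sum is small once l q q^* is close to 1, so it remains to control
    \<open>q\<close> and the ratio \<open>l\<close> of the two constants.\<close>
  have refl: "G z + cnj (G (1 / cnj z))
      = 2 * of_real \<kappa> / (\<phi> z * cnj (\<phi> (1 / cnj z))) * (1 - of_real l * (q z * cnj (q (1 / cnj z))))"
    if z: "z \<noteq> 0" "cmod z < 1 + \<delta>" "cmod (1 / cnj z) < 1 + \<delta>" for z
  proof -
    define y where "y = 1 / cnj z"
    have ny: "\<phi> z \<noteq> 0" "\<phi>' z \<noteq> 0" "cnj (\<phi> y) \<noteq> 0" "cnj (\<phi>' y) \<noteq> 0"
      using nz z by (auto simp: y_def)
    have c: "cnj (\<phi> y) = cnj (a y) + cnj (b y) / z" "cnj (\<phi>' y) = cnj (a' y) + cnj (b' y) / z"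
      by (simp_all add: \<phi>_def \<phi>'_def y_def)
    have d: "cnj (a y - y * b y) = cnj (a y) - cnj (b y) / z" "cnj (a' y - y * b' y) = cnj (a' y) - cnj (b' y) / z"
      by (simp_all add: y_def)
    have 1: "(a z - z * b z) / \<phi> z + cnj ((a y - y * b y) / \<phi> y) = 2 * of_real \<kappa> / (\<phi> z * cnj (\<phi> y))"
      using caratheodory_reflection[OF z(1), of "a z" "b z" "cnj (a y)" "cnj (b y)"] ny(1,3) id(1)[OF z(1)]
      unfolding complex_cnj_divide c d y_def[symmetric] by (simp add: \<phi>_def)
    have 2: "(a' z - z * b' z) / \<phi>' z + cnj ((a' y - y * b' y) / \<phi>' y) = 2 * of_real \<kappa>' / (\<phi>' z * cnj (\<phi>' y))"
      using caratheodory_reflection[OF z(1), of "a' z" "b' z" "cnj (a' y)" "cnj (b' y)"] ny(2,4) id(2)[OF z(1)]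
      unfolding complex_cnj_divide c d y_def[symmetric] by (simp add: \<phi>'_def)
    have "G z + cnj (G y) = ((a z - z * b z) / \<phi> z + cnj ((a y - y * b y) / \<phi> y))
       - ((a' z - z * b' z) / \<phi>' z + cnj ((a' y - y * b' y) / \<phi>' y))"
      by (simp add: G_def)
    also have "\<dots> = 2 * of_real \<kappa> / (\<phi> z * cnj (\<phi> y)) - 2 * of_real \<kappa>' / (\<phi>' z * cnj (\<phi>' y))"
      unfolding 1 2 ..
    also have "\<dots> = 2 * of_real \<kappa> / (\<phi> z * cnj (\<phi> y)) * (1 - of_real l * (q z * cnj (q y)))"
      using ny \<kappa> by (simp add: q_def l_def right_diff_distrib)
    finally show ?thesis by (simp add: y_def)
  qed
  \<comment> \<open>A point of the unit circle is its own reflection, so the identity becomes real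
    and Re G has the sign of 1 - l |q|^2.\<close>
  have circle: "Re (G z) = \<kappa> / (cmod (\<phi> z))\<^sup>2 * (1 - l * (cmod (q z))\<^sup>2)" if z: "cmod z = 1" for z
  proof -
    have "z \<noteq> 0" using z by auto
    then have iz: "1 / cnj z = z"
      using complex_norm_square[of z] z by (simp add: field_simps)
    have "G z + cnj (G z) = 2 * of_real \<kappa> / (\<phi> z * cnj (\<phi> z)) * (1 - of_real l * (q z * cnj (q z)))"
      using refl[of z] z \<delta> iz \<open>z \<noteq> 0\<close> by auto
    also have "\<dots> = of_real (2 * (\<kappa> / (cmod (\<phi> z))\<^sup>2 * (1 - l * (cmod (q z))\<^sup>2)))"
      unfolding complex_norm_square[symmetric] by simp
    finally have "of_real (2 * Re (G z)) = (of_real (2 * (\<kappa> / (cmod (\<phi> z))\<^sup>2 * (1 - l * (cmod (q z))\<^sup>2))) :: complex)"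
      by (simp add: complex_add_cnj)
    then show ?thesis unfolding of_real_eq_iff by simp
  qed
  have qb: "1 - \<theta> \<le> cmod (q z)" "cmod (q z) \<le> 1 + \<theta>" if "cmod z \<le> 1 + \<delta> / 4" for z
  proof -
    have "cmod (q z) - 1 \<le> cmod (q z - 1)" "1 - cmod (q z) \<le> cmod (1 - q z)"
      using norm_triangle_ineq2[of "q z" 1] norm_triangle_ineq2[of 1 "q z"] by simp_all
    then show "1 - \<theta> \<le> cmod (q z)" "cmod (q z) \<le> 1 + \<theta>"
      using near[OF that] norm_minus_commute[of 1 "q z"] by (auto simp: q_def)
  qed
  have pos: "\<kappa> / (cmod (\<phi> z))\<^sup>2 > 0" if "cmod z = 1" for z
    using \<kappa> nz(1)[of z] that \<delta> by simp
  \<comment> \<open>Points with Re G <= 0 and with Re G >= 0 bound \<open>l\<close> from below and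
    from above, as |q| lies between 1 - \<theta> and 1 + \<theta>.\<close>
  obtain x where x: "cmod x = 1" "Re (G x) \<le> 0"
    using exists_Re_nonpos[OF holG _ G0] \<delta> by auto
  obtain y where y: "cmod y = 1" "Re (- G y) \<le> 0"
    using exists_Re_nonpos[of "\<lambda>z. - G z" "1 + \<delta>"] G0 \<delta> holomorphic_on_minus[OF holG] by auto
  have l1: "1 \<le> l * (1 + \<theta>)\<^sup>2"
  proof -
    have "1 - l * (cmod (q x))\<^sup>2 \<le> 0"
      using x(2) pos[OF x(1)] unfolding circle[OF x(1)] mult_le_0_iff by auto
    moreover have "(cmod (q x))\<^sup>2 \<le> (1 + \<theta>)\<^sup>2" using qb(2)[of x] x \<delta> by (intro power_mono) auto
    ultimately show ?thesis using l mult_left_mono[of "(cmod (q x))\<^sup>2" "(1 + \<theta>)\<^sup>2" l] by linarith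
  qed
  have l2: "l * (1 - \<theta>)\<^sup>2 \<le> 1"
  proof -
    have "1 - l * (cmod (q y))\<^sup>2 \<ge> 0"
      using y(2) pos[OF y(1)] unfolding uminus_complex.sel circle[OF y(1)] neg_le_0_iff_le zero_le_mult_iff by auto
    moreover have "(1 - \<theta>)\<^sup>2 \<le> (cmod (q y))\<^sup>2" using qb(1)[of y] y \<delta> \<theta> by (intro power_mono) auto
    ultimately show ?thesis using l mult_left_mono[of "(1 - \<theta>)\<^sup>2" "(cmod (q y))\<^sup>2" l] by linarith
  qed
  have l4: "l \<le> 4"
  proof -
    have "(1 / 2)\<^sup>2 \<le> (1 - \<theta>)\<^sup>2" using \<theta> by (intro power_mono) auto
    then have "l * (1 / 2)\<^sup>2 \<le> l * (1 - \<theta>)\<^sup>2" using l by (intro mult_left_mono) auto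
    then show ?thesis using l2 by (simp add: power2_eq_square)
  qed
  have t2: "2 * \<theta> + \<theta>\<^sup>2 \<le> 5 / 2 * \<theta>" using \<theta> \<theta>0 mult_right_mono[of \<theta> "1/2" \<theta>] by (simp add: power2_eq_square)
  have labs: "\<bar>l - 1\<bar> \<le> 10 * \<theta>"
  proof -
    have "l - 1 \<le> l * (2 * \<theta> - \<theta>\<^sup>2)" using l2 by (simp add: power2_eq_square algebra_simps)
    also have "\<dots> \<le> 4 * (5 / 2 * \<theta>)"
    proof (rule mult_mono)
      show "2 * \<theta> - \<theta>\<^sup>2 \<le> 5 / 2 * \<theta>" using \<theta>0 zero_le_power2[of \<theta>] by linarith
      show "0 \<le> 2 * \<theta> - \<theta>\<^sup>2" using \<theta> \<theta>0 t2 by linarith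
    qed (use l4 in auto)
    finally have 1: "l - 1 \<le> 10 * \<theta>" by simp
    have "1 - l \<le> l * (2 * \<theta> + \<theta>\<^sup>2)" using l1 by (simp add: power2_eq_square algebra_simps)
    also have "\<dots> \<le> 4 * (5 / 2 * \<theta>)"
      by (rule mult_mono) (use l4 t2 \<theta>0 in auto)
    finally show ?thesis using 1 by simp
  qed
  have H: "cmod (G z + cnj (G (1 / cnj z))) \<le> 40 * exp (2 * B) * \<theta>" if z: "cmod z = r" for z
  proof -
    define y where "y = 1 / cnj z"
    have "1 / r \<le> 1" using r by simp
    then have "1 / r \<le> r" using r by linarith
    then have ry: "cmod y \<le> r" using z by (simp add: y_def norm_divide)
    have "z \<noteq> 0" using z r by auto
    \<comment> \<open>Expanding about q = 1 leaves \<open>l\<close> times three terms with a factor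
      q - 1, plus l - 1. With l <= 4 and |l - 1| <= 10 \<theta> either part is at most 10
      \<theta>.\<close>
    have "cmod (1 - of_real l * (q z * cnj (q y)))
        = cmod (of_real l * ((q z - 1) * cnj (q y - 1) + (q z - 1) + cnj (q y - 1)) + of_real (l - 1))"
      by (subst norm_minus_commute) (simp add: algebra_simps)
    also have "\<dots> \<le> cmod (of_real l * ((q z - 1) * cnj (q y - 1) + (q z - 1) + cnj (q y - 1))) + cmod (of_real (l - 1))"
      by (rule norm_triangle_ineq)
    also have "\<dots> = l * cmod ((q z - 1) * cnj (q y - 1) + (q z - 1) + cnj (q y - 1)) + \<bar>l - 1\<bar>"
      using l by (simp add: norm_mult del: of_real_diff)
    also have "\<dots> \<le> 4 * (5 / 2 * \<theta>) + 10 * \<theta>"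
    proof (intro add_mono mult_mono labs l4)
      have 1: "cmod (q z - 1) \<le> \<theta>" "cmod (q y - 1) \<le> \<theta>"
        using near[of z] near[of y] z ry by (auto simp: q_def r_def)
      have "cmod ((q z - 1) * cnj (q y - 1) + (q z - 1) + cnj (q y - 1))
          \<le> cmod ((q z - 1) * cnj (q y - 1)) + cmod (q z - 1) + cmod (cnj (q y - 1))"
        by (meson add_mono norm_triangle_ineq norm_triangle_mono order_refl)
      also have "\<dots> \<le> \<theta> * \<theta> + \<theta> + \<theta>"
        unfolding norm_mult complex_mod_cnj using 1 \<theta>0 by (intro add_mono mult_mono) auto
      also have "\<dots> \<le> 5 / 2 * \<theta>" using t2 by (simp add: power2_eq_square)
      finally show "cmod ((q z - 1) * cnj (q y - 1) + (q z - 1) + cnj (q y - 1)) \<le> 5 / 2 * \<theta>" .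
    qed auto
    finally have fac: "cmod (1 - of_real l * (q z * cnj (q y))) \<le> 20 * \<theta>" by simp
    have "exp (- B) * exp (- B) \<le> cmod (\<phi> z) * cmod (\<phi> y)"
      using lb[of z] lb[of y] z ry by (intro mult_mono) (auto simp: r_def)
    then have "2 * \<kappa> / (cmod (\<phi> z) * cmod (\<phi> y)) \<le> 2 * 1 / (exp (- B) * exp (- B))"
      using \<kappa> by (intro frac_le) auto
    also have "\<dots> = 2 * exp (2 * B)" by (simp add: exp_minus field_simps flip: exp_add)
    finally have "2 * \<kappa> / (cmod (\<phi> z) * cmod (\<phi> y)) * cmod (1 - of_real l * (q z * cnj (q y)))
       \<le> 2 * exp (2 * B) * (20 * \<theta>)"
      using fac \<kappa> by (intro mult_mono) auto
    moreover have "cmod (G z + cnj (G (1 / cnj z))) = 2 * \<kappa> / (cmod (\<phi> z) * cmod (\<phi> y)) * cmod (1 - of_real l * (q z * cnj (q y)))"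
      using refl[of z] \<open>z \<noteq> 0\<close> z r ry \<kappa> by (simp add: y_def[symmetric] norm_mult norm_divide)
    ultimately show ?thesis by simp
  qed
  have "cmod (G z) \<le> cmod z * (40 * exp (2 * B) * \<theta> * r / (r\<^sup>2 - 1))"
    by (rule bound_by_reflection[OF holG r(1,2) G0 H]) (use z r in auto)
  also have "\<dots> \<le> cmod z * (40 * exp (2 * B) * \<theta> * (3 / \<delta>))"
  proof -
    have "r / (r\<^sup>2 - 1) \<le> (5 / 4) / (\<delta> / 2)"
      by (rule frac_le) (use r \<delta> in \<open>auto simp: r_def power2_eq_square algebra_simps\<close>)
    also have "\<dots> \<le> 3 / \<delta>" using \<delta> by (simp add: field_simps)
    finally have "40 * exp (2 * B) * \<theta> * (r / (r\<^sup>2 - 1)) \<le> 40 * exp (2 * B) * \<theta> * (3 / \<delta>)"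
      using \<theta>0 by (intro mult_left_mono) auto
    then show ?thesis by (intro mult_left_mono) auto
  qed
  finally show ?thesis by (simp add: G_def mult_ac)
qed

subsection \<open>The Szego recursion\<close>

definition shift :: "(nat \<Rightarrow> 'a) \<Rightarrow> nat \<Rightarrow> 'a" where
  "shift \<alpha> = (\<lambda>j. \<alpha> (Suc j))"

lemma shift_apply: "shift \<alpha> j = \<alpha> (Suc j)"
  by (simp add: shift_def)

lemma funpow_shift: "(shift ^^ k) \<alpha> j = \<alpha> (k + j)"
  by (induction k arbitrary: j) (auto simp: shift_apply)

text \<open>These are \<open>a\<^sub>0\<close> and \<open>b\<^sub>0\<close> for the sequence cut off
  after its n-th coefficient, where the tail has a = 1 and b = 0. Recursing on the shifted sequence
  peels off the first coefficient, as the Schur algorithm does.\<close>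

fun szego_a szego_b :: "nat \<Rightarrow> (nat \<Rightarrow> complex) \<Rightarrow> complex \<Rightarrow> complex" where
  "szego_a 0 \<alpha> z = 1"
| "szego_b 0 \<alpha> z = 0"
| "szego_a (Suc n) \<alpha> z = szego_a n (shift \<alpha>) z + \<alpha> (Suc 0) * z * szego_b n (shift \<alpha>) z"
| "szego_b (Suc n) \<alpha> z = cnj (\<alpha> (Suc 0)) * szego_a n (shift \<alpha>) z + z * szego_b n (shift \<alpha>) z"

lemma holomorphic_szego:
  "szego_a n \<alpha> holomorphic_on S \<and> szego_b n \<alpha> holomorphic_on S"
proof (induction n arbitrary: \<alpha>)
  case 0
  have "szego_a 0 \<alpha> = (\<lambda>_. 1)" "szego_b 0 \<alpha> = (\<lambda>_. 0)" by auto
  then show ?case by simp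
next
  case (Suc n)
  have "(\<lambda>z. szego_a n (shift \<alpha>) z + \<alpha> (Suc 0) * z * szego_b n (shift \<alpha>) z) holomorphic_on S"
    "(\<lambda>z. cnj (\<alpha> (Suc 0)) * szego_a n (shift \<alpha>) z + z * szego_b n (shift \<alpha>) z) holomorphic_on S"
    using Suc[of "shift \<alpha>"] by (auto intro!: holomorphic_intros)
  then show ?case by simp
qed

lemma szego_at_0: "szego_a n \<alpha> 0 = 1"
  by (induction n arbitrary: \<alpha>) auto

lemma prod_shift:
  fixes f :: "nat \<Rightarrow> 'a" and g :: "'a \<Rightarrow> 'b::comm_monoid_mult"
  shows "(\<Prod>j<Suc n. g (f (Suc j))) = g (f (Suc 0)) * (\<Prod>j<n. g (shift f (Suc j)))"
  unfolding shift_apply by (rule prod.lessThan_Suc_shift)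

text \<open>Each step multiplies the form a a^* - b b^* by 1 - |t|^2, where t is the coefficient
  peeled off.\<close>

lemma szego_reflection:
  assumes "z \<noteq> 0"
  shows "szego_a n \<alpha> z * cnj (szego_a n \<alpha> (1 / cnj z)) - szego_b n \<alpha> z * cnj (szego_b n \<alpha> (1 / cnj z))
    = of_real (\<Prod>j<n. 1 - (cmod (\<alpha> (Suc j)))\<^sup>2)"
proof (induction n arbitrary: \<alpha>)
  case (Suc n)
  have alg: "(a + t * z * b) * (a' + cnj t * (1 / z) * b') - (cnj t * a + z * b) * (t * a' + (1 / z) * b')
    = (1 - t * cnj t) * (a * a' - b * b')" for a b a' b' t :: complex
    using assms by (simp add: field_simps)
  have "of_real (1 - (cmod (\<alpha> (Suc 0)))\<^sup>2) = 1 - \<alpha> (Suc 0) * cnj (\<alpha> (Suc 0))"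
    by (simp add: complex_norm_square flip: of_real_power)
  then show ?case
    using alg[of "szego_a n (shift \<alpha>) z" "\<alpha> (Suc 0)" "szego_b n (shift \<alpha>) z"
        "cnj (szego_a n (shift \<alpha>) (1 / cnj z))" "cnj (szego_b n (shift \<alpha>) (1 / cnj z))"] Suc[of "shift \<alpha>"]
    unfolding prod_shift[of "\<lambda>x. 1 - (cmod x)\<^sup>2"] of_real_mult by simp
qed simp

text \<open>In the step identity for |a|^2 - |b|^2 the previous b occurs as z b. Since |z b| <= |b|
  in the disk, the product becomes a lower bound.\<close>

lemma szego_Schur:
  assumes z: "cmod z \<le> 1" and lt: "\<And>j. cmod (\<alpha> (Suc j)) \<le> 1"
  shows "(\<Prod>j<n. 1 - (cmod (\<alpha> (Suc j)))\<^sup>2) \<le> (cmod (szego_a n \<alpha> z))\<^sup>2 - (cmod (szego_b n \<alpha> z))\<^sup>2"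
  using lt
proof (induction n arbitrary: \<alpha>)
  case (Suc n)
  define a where "a = szego_a n (shift \<alpha>) z"
  define b where "b = szego_b n (shift \<alpha>) z"
  define t where "t = \<alpha> (Suc 0)"
  have alg: "(cmod (a + t * z * b))\<^sup>2 - (cmod (cnj t * a + z * b))\<^sup>2 = (1 - (cmod t)\<^sup>2) * ((cmod a)\<^sup>2 - (cmod (z * b))\<^sup>2)"
  proof -
    have "of_real ((cmod (a + t * z * b))\<^sup>2 - (cmod (cnj t * a + z * b))\<^sup>2)
      = (of_real ((1 - (cmod t)\<^sup>2) * ((cmod a)\<^sup>2 - (cmod (z * b))\<^sup>2)) :: complex)"
      unfolding of_real_diff of_real_mult of_real_1 complex_norm_square by (simp add: algebra_simps)
    then show ?thesis unfolding of_real_eq_iff .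
  qed
  have t1: "0 \<le> 1 - (cmod t)\<^sup>2" using Suc.prems[of 0] by (simp add: t_def power_le_one)
  have "cmod (z * b) \<le> cmod b" using z by (simp add: norm_mult mult_left_le_one_le)
  then have "(cmod (z * b))\<^sup>2 \<le> (cmod b)\<^sup>2" by (intro power_mono) auto
  moreover have "(\<Prod>j<n. 1 - (cmod (shift \<alpha> (Suc j)))\<^sup>2) \<le> (cmod a)\<^sup>2 - (cmod b)\<^sup>2"
    unfolding a_def b_def by (rule Suc.IH) (use Suc.prems in \<open>auto simp: shift_apply\<close>)
  ultimately have "(1 - (cmod t)\<^sup>2) * (\<Prod>j<n. 1 - (cmod (shift \<alpha> (Suc j)))\<^sup>2)
     \<le> (1 - (cmod t)\<^sup>2) * ((cmod a)\<^sup>2 - (cmod (z * b))\<^sup>2)"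
    using t1 by (intro mult_left_mono) linarith+
  then show ?case
    unfolding alg[symmetric] prod_shift[of "\<lambda>x. 1 - (cmod x)\<^sup>2"] by (simp add: a_def b_def t_def)
qed simp

text \<open>The additional coefficient enters at the innermost step only, where it changes b by its
  conjugate; each outer step is linear in (a, b) and enlarges the change by at most (1 + |t|)
  r.\<close>

lemma szego_diff:
  assumes z: "cmod z \<le> r" and r: "r \<ge> 1"
  shows "cmod (szego_a (Suc n) \<alpha> z - szego_a n \<alpha> z) \<le> (\<Prod>j<n. 1 + cmod (\<alpha> (Suc j))) * (r ^ n * cmod (\<alpha> (Suc n)))
    \<and> cmod (szego_b (Suc n) \<alpha> z - szego_b n \<alpha> z) \<le> (\<Prod>j<n. 1 + cmod (\<alpha> (Suc j))) * (r ^ n * cmod (\<alpha> (Suc n)))"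
proof (induction n arbitrary: \<alpha>)
  case (Suc n)
  define X where "X = (\<Prod>j<n. 1 + cmod (shift \<alpha> (Suc j))) * (r ^ n * cmod (shift \<alpha> (Suc n)))"
  define da where "da = szego_a (Suc n) (shift \<alpha>) z - szego_a n (shift \<alpha>) z"
  define db where "db = szego_b (Suc n) (shift \<alpha>) z - szego_b n (shift \<alpha>) z"
  define t where "t = \<alpha> (Suc 0)"
  have IH: "cmod da \<le> X" "cmod db \<le> X" using Suc[of "shift \<alpha>"] unfolding X_def da_def db_def by auto
  have X0: "X \<ge> 0" using IH(1) norm_ge_zero order_trans by blast
  have eqX: "(\<Prod>j<Suc n. 1 + cmod (\<alpha> (Suc j))) * (r ^ Suc n * cmod (\<alpha> (Suc (Suc n)))) = (1 + cmod t) * r * X"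
    unfolding prod_shift[of "\<lambda>x. 1 + cmod x"] by (simp add: X_def t_def shift_apply[of \<alpha> "Suc n"])
  have zd: "cmod (z * db) \<le> r * X" unfolding norm_mult using z IH r by (intro mult_mono) auto
  have rX: "X \<le> r * X" using r X0 mult_right_mono[of 1 r X] by simp
  have "szego_a (Suc (Suc n)) \<alpha> z - szego_a (Suc n) \<alpha> z = da + t * (z * db)"
    unfolding szego_a.simps(2)[of "Suc n" \<alpha>] szego_a.simps(2)[of n \<alpha>] da_def db_def t_def by (simp only: algebra_simps)
  then have "cmod (szego_a (Suc (Suc n)) \<alpha> z - szego_a (Suc n) \<alpha> z) \<le> cmod da + cmod t * cmod (z * db)"
    by (metis norm_mult norm_triangle_ineq)
  also have "\<dots> \<le> r * X + cmod t * (r * X)"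
    by (intro add_mono mult_left_mono zd) (use IH rX in auto)
  finally have 1: "cmod (szego_a (Suc (Suc n)) \<alpha> z - szego_a (Suc n) \<alpha> z) \<le> (1 + cmod t) * r * X"
    by (simp add: algebra_simps)
  have "szego_b (Suc (Suc n)) \<alpha> z - szego_b (Suc n) \<alpha> z = cnj t * da + z * db"
    unfolding szego_b.simps(2)[of "Suc n" \<alpha>] szego_b.simps(2)[of n \<alpha>] da_def db_def t_def by (simp only: algebra_simps)
  then have "cmod (szego_b (Suc (Suc n)) \<alpha> z - szego_b (Suc n) \<alpha> z) \<le> cmod t * cmod da + cmod (z * db)"
    by (metis complex_mod_cnj norm_mult norm_triangle_ineq)
  also have "\<dots> \<le> cmod t * (r * X) + r * X"
    by (intro add_mono mult_left_mono zd) (use IH rX in auto)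
  finally have 2: "cmod (szego_b (Suc (Suc n)) \<alpha> z - szego_b (Suc n) \<alpha> z) \<le> (1 + cmod t) * r * X"
    by (simp add: algebra_simps)
  show ?case unfolding eqX using 1 2 by blast
qed auto

section \<open>Limits of the truncated recursion and the class of coefficient sequences\<close>

lemma geometric_increments_limit:
  fixes X :: "nat \<Rightarrow> complex"
  assumes "\<And>n. cmod (X (Suc n) - X n) \<le> K * (1 / 2) ^ Suc n"
  shows "X \<longlonglongrightarrow> lim X" and "cmod (lim X - X n) \<le> K * (1 / 2) ^ n"
proof -
  have tail: "cmod (X (n + m) - X n) \<le> K * (1 / 2) ^ n" for n m
  proof -
    have "0 \<le> K * (1 / 2) ^ Suc 0" using assms[of 0] norm_ge_zero order_trans by blast
    then have "K \<ge> 0" by simp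
    have "cmod (X (n + m) - X n) \<le> K * ((1 / 2) ^ n - (1 / 2) ^ (n + m))"
    proof (induction m)
      case (Suc m)
      have "cmod (X (n + Suc m) - X n) \<le> cmod (X (Suc (n + m)) - X (n + m)) + cmod (X (n + m) - X n)"
        by (metis add_Suc_right diff_add_cancel add_diff_eq norm_triangle_ineq)
      also have "\<dots> \<le> K * (1 / 2) ^ Suc (n + m) + K * ((1 / 2) ^ n - (1 / 2) ^ (n + m))"
        by (intro add_mono assms Suc)
      also have "\<dots> = K * ((1 / 2) ^ n - (1 / 2) ^ (n + Suc m))" by (simp add: algebra_simps)
      finally show ?case .
    qed simp
    also have "\<dots> \<le> K * (1 / 2) ^ n" using \<open>K \<ge> 0\<close> by (intro mult_left_mono) auto
    finally show ?thesis .
  qed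
  have "summable (\<lambda>n. X (Suc n) - X n)"
  proof (rule summable_comparison_test)
    show "summable (\<lambda>n. K * (1 / 2) ^ Suc n)"
      by (intro summable_mult) (subst summable_Suc_iff, simp add: summable_geometric)
  qed (use assms in auto)
  then have "(\<lambda>n. X n - X 0) \<longlonglongrightarrow> (\<Sum>n. X (Suc n) - X n)"
    using summable_LIMSEQ[of "\<lambda>n. X (Suc n) - X n"] by (simp only: sum_lessThan_telescope)
  then have "(\<lambda>n. X n - X 0 + X 0) \<longlonglongrightarrow> (\<Sum>n. X (Suc n) - X n) + X 0"
    by (intro tendsto_intros)
  then have "convergent X" by (auto simp: convergent_def)
  then show L: "X \<longlonglongrightarrow> lim X" by (simp add: convergent_LIMSEQ_iff)
  have "(\<lambda>m. cmod (X (n + m) - X n)) \<longlonglongrightarrow> cmod (lim X - X n)"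
    by (intro tendsto_intros LIMSEQ_ignore_initial_segment[OF L, of n, unfolded add.commute[of _ n]])
  then show "cmod (lim X - X n) \<le> K * (1 / 2) ^ n"
    by (rule LIMSEQ_le_const2) (use tail in auto)
qed

definition jost_a :: "(nat \<Rightarrow> complex) \<Rightarrow> complex \<Rightarrow> complex" where
  "jost_a \<alpha> z = lim (\<lambda>n. szego_a n \<alpha> z)"

definition jost_b :: "(nat \<Rightarrow> complex) \<Rightarrow> complex \<Rightarrow> complex" where
  "jost_b \<alpha> z = lim (\<lambda>n. szego_b n \<alpha> z)"

text \<open>A bound for all finite sections replaces the infinite product: it passes to shifted
  sequences and applies directly to the truncated recursion.\<close>

definition decay_class :: "real \<Rightarrow> real \<Rightarrow> real \<Rightarrow> (nat \<Rightarrow> complex) set" where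
  "decay_class \<gamma> \<eta> Q = {\<alpha>. (\<forall>k\<ge>1. cmod (\<alpha> k) < 1 \<and> cmod (\<alpha> k) \<le> \<eta> * exp (- (real k powr \<gamma>))) \<and>
     (\<forall>n. 1 / Q \<le> (\<Prod>j<n. 1 - cmod (\<alpha> (Suc j))))}"

subsection \<open>Solution of the Volterra equations\<close>

lemma vec2_sums:
  fixes f :: "nat \<Rightarrow> complex^2"
  assumes "(\<lambda>n. f n $ 1) sums a" "(\<lambda>n. f n $ 2) sums b"
  shows "f sums vector [a, b]"
  unfolding sums_def
proof (rule vec_tendstoI)
  fix i :: 2
  show "(\<lambda>n. (\<Sum>i<n. f i) $ i) \<longlonglongrightarrow> (vector [a, b] :: complex^2) $ i"
    using assms exhaust_2[of i] by (auto simp: sums_def sum_component)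
qed

lemma sums_vec_nth:
  fixes f :: "nat \<Rightarrow> 'a::real_normed_vector ^ 'n::finite"
  shows "f sums a \<Longrightarrow> (\<lambda>n. f n $ i) sums (a $ i)"
  by (rule bounded_linear.sums[OF bounded_linear_vec_nth])

lemma sums_geometric_bound:
  fixes f :: "nat \<Rightarrow> 'a::banach"
  assumes f: "f sums s" and le: "\<And>n. norm (f n) \<le> C * (1 / 2) ^ Suc n"
  shows "norm s \<le> C"
proof -
  have half: "(\<lambda>n. C * (1 / 2) ^ Suc n) sums C"
    using sums_mult[OF power_half_series, of C] by simp
  have "norm (\<Sum>n. f n) \<le> (\<Sum>n. C * (1 / 2) ^ Suc n)"
    by (rule norm_suminf_le[OF le sums_summable[OF half]])
  then show ?thesis using f half by (simp only: sums_iff)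
qed

lemma volterra_kernel_mult:
  "volterra_kernel \<alpha> z k (k + 1 + j) *v F (k + 1 + j) =
    vector [\<alpha> (Suc (k + j)) * zeta z (Suc (k + j)) * F (Suc (k + j)) $ 2,
            z ^ j * cnj (\<alpha> (Suc (k + j))) * zeta z (Suc k) * F (Suc (k + j)) $ 1]"
  by (simp add: volterra_kernel_def vec_eq_iff forall_2 matrix_vector_mult_def sum_2)

lemma zeta_mult_zeta_Suc: "zeta z n * zeta z (Suc n) = z"
  by (simp add: zeta_def)

locale verblunsky_decay =
  fixes \<gamma> \<eta> Q :: real
  assumes \<gamma>: "\<gamma> > 1" and \<eta>: "\<eta> > 0" and Q: "Q > 1"
begin

abbreviation cls :: "(nat \<Rightarrow> complex) set" where
  "cls \<equiv> decay_class \<gamma> \<eta> Q"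

definition decay_bound :: "real \<Rightarrow> real" where
  "decay_bound r = \<eta> * exp ((ln r + 1) powr (\<gamma> / (\<gamma> - 1)))"

text \<open>For L = ln r + 1, x L - x^\<gamma> is nonpositive if L <= x^(\<gamma>-1); otherwise x <
  L^(1/(\<gamma>-1)), so it is at most L^(\<gamma>/(\<gamma>-1)). The extra 1 in L pays for a factor
  exp (- x) <= 2^(-x), which makes the increments geometric.\<close>

lemma weight_le:
  assumes r: "r \<ge> 1"
  shows "r ^ n * (\<eta> * exp (- (real (Suc n) powr \<gamma>))) \<le> decay_bound r * (1 / 2) ^ Suc n"
proof -
  define x where "x = real (Suc n)"
  define L where "L = ln r + 1"
  have x: "x > 0" by (simp add: x_def)
  have L: "L \<ge> 1" using r by (simp add: L_def)
  have "x * L - x powr \<gamma> \<le> L powr (\<gamma> / (\<gamma> - 1))"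
  proof (cases "L \<le> x powr (\<gamma> - 1)")
    case True
    then have "x * L \<le> x * x powr (\<gamma> - 1)" using x by (intro mult_left_mono) auto
    also have "\<dots> = x powr \<gamma>" using x by (simp add: powr_mult_base)
    finally have "x * L - x powr \<gamma> \<le> 0" by simp
    then show ?thesis using powr_ge_zero by (rule order_trans)
  next
    case False
    have "x = (x powr (\<gamma> - 1)) powr (1 / (\<gamma> - 1))" using x \<gamma> by (simp add: powr_powr)
    also have "\<dots> \<le> L powr (1 / (\<gamma> - 1))" using False \<gamma> by (intro powr_mono2) auto
    finally have "x * L \<le> L * L powr (1 / (\<gamma> - 1))" using L by (simp add: mult.commute)
    also have "\<dots> = L powr (1 + 1 / (\<gamma> - 1))" using L by (simp add: powr_mult_base)
    also have "1 + 1 / (\<gamma> - 1) = \<gamma> / (\<gamma> - 1)" using \<gamma> by (simp add: field_simps)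
    finally show ?thesis using powr_ge_zero[of x \<gamma>] by linarith
  qed
  then have "x * ln r - x powr \<gamma> \<le> L powr (\<gamma> / (\<gamma> - 1)) - x" by (simp add: L_def algebra_simps)
  then have "exp (x * ln r - x powr \<gamma>) \<le> exp (L powr (\<gamma> / (\<gamma> - 1)) - x)" by simp
  moreover have "exp (x * ln r) = r ^ Suc n"
    using r unfolding x_def by (simp add: exp_of_nat_mult del: of_nat_Suc power_Suc)
  ultimately have 1: "r ^ Suc n * exp (- (x powr \<gamma>)) \<le> exp (L powr (\<gamma> / (\<gamma> - 1))) * exp (- x)"
    by (simp add: exp_diff exp_minus divide_inverse)
  have "exp (- x) = exp (- 1 :: real) ^ Suc n"
    unfolding x_def exp_of_nat_mult[symmetric] by simp
  moreover have "exp (- 1 :: real) \<le> 1 / 2"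
    using exp_ge_add_one_self[of 1] by (simp add: exp_minus field_simps)
  ultimately have 2: "exp (- x) \<le> (1 / 2) ^ Suc n" by (metis exp_ge_zero power_mono)
  have "r ^ n * exp (- (x powr \<gamma>)) \<le> r ^ Suc n * exp (- (x powr \<gamma>))"
    using r by (intro mult_right_mono power_increasing) auto
  also have "\<dots> \<le> exp (L powr (\<gamma> / (\<gamma> - 1))) * (1 / 2) ^ Suc n"
    using 1 2 by (meson exp_ge_zero mult_left_mono order_trans)
  finally have "\<eta> * (r ^ n * exp (- (x powr \<gamma>))) \<le> \<eta> * (exp (L powr (\<gamma> / (\<gamma> - 1))) * (1 / 2) ^ Suc n)"
    using \<eta> by (intro mult_left_mono) auto
  then show ?thesis by (simp add: decay_bound_def x_def L_def mult_ac)
qed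

lemma cls_lt_1: "\<alpha> \<in> cls \<Longrightarrow> cmod (\<alpha> (Suc j)) < 1"
  by (auto simp: decay_class_def)

lemma cls_decay:
  assumes "\<alpha> \<in> cls" "r \<ge> 1"
  shows "r ^ n * cmod (\<alpha> (Suc n)) \<le> decay_bound r * (1 / 2) ^ Suc n"
proof -
  have "cmod (\<alpha> (Suc n)) \<le> \<eta> * exp (- (real (Suc n) powr \<gamma>))"
    using assms(1) unfolding decay_class_def by auto
  then have "r ^ n * cmod (\<alpha> (Suc n)) \<le> r ^ n * (\<eta> * exp (- (real (Suc n) powr \<gamma>)))"
    using assms(2) by (intro mult_left_mono) auto
  then show ?thesis using weight_le[OF assms(2), of n] by linarith
qed

lemma cls_shift:
  assumes "\<alpha> \<in> cls"
  shows "shift \<alpha> \<in> cls"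
proof -
  have "cmod (shift \<alpha> k) \<le> \<eta> * exp (- (real k powr \<gamma>))" if "k \<ge> 1" for k
  proof -
    have "cmod (shift \<alpha> k) \<le> \<eta> * exp (- (real (Suc k) powr \<gamma>))"
      using assms unfolding decay_class_def shift_apply by auto
    also have "\<dots> \<le> \<eta> * exp (- (real k powr \<gamma>))"
      using \<eta> \<gamma> by (intro mult_left_mono) (auto intro!: powr_mono2)
    finally show ?thesis .
  qed
  moreover have "1 / Q \<le> (\<Prod>j<n. 1 - cmod (shift \<alpha> (Suc j)))" for n
  proof -
    have "1 / Q \<le> (\<Prod>j<Suc n. 1 - cmod (\<alpha> (Suc j)))"
      using assms unfolding decay_class_def by blast
    also have "\<dots> = (1 - cmod (\<alpha> (Suc 0))) * (\<Prod>j<n. 1 - cmod (shift \<alpha> (Suc j)))"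
      by (rule prod_shift)
    also have "\<dots> \<le> 1 * (\<Prod>j<n. 1 - cmod (shift \<alpha> (Suc j)))"
      using cls_lt_1[OF assms] by (intro mult_right_mono prod_nonneg) (auto simp: shift_apply less_imp_le)
    finally show ?thesis by simp
  qed
  ultimately show ?thesis using cls_lt_1[OF assms] by (simp add: decay_class_def shift_apply)
qed

lemma cls_funpow_shift: "\<alpha> \<in> cls \<Longrightarrow> (shift ^^ k) \<alpha> \<in> cls"
  by (induction k) (auto intro: cls_shift)

lemma cls_prod_ge: "\<alpha> \<in> cls \<Longrightarrow> 1 / Q \<le> (\<Prod>j<n. 1 - cmod (\<alpha> (Suc j)))"
  by (auto simp: decay_class_def)

lemma cls_one_minus_ge:
  assumes "\<alpha> \<in> cls"
  shows "1 / Q \<le> 1 - cmod (\<alpha> (Suc 0))"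
  using cls_prod_ge[OF assms, of 1] by simp

lemma cls_prod_square_ge:
  assumes "\<alpha> \<in> cls"
  shows "1 / Q \<le> (\<Prod>j<n. 1 - (cmod (\<alpha> (Suc j)))\<^sup>2)"
proof -
  have "(\<Prod>j<n. 1 - cmod (\<alpha> (Suc j))) \<le> (\<Prod>j<n. 1 - (cmod (\<alpha> (Suc j)))\<^sup>2)"
  proof (rule prod_mono)
    fix j
    have "cmod (\<alpha> (Suc j)) * cmod (\<alpha> (Suc j)) \<le> cmod (\<alpha> (Suc j))"
      using cls_lt_1[OF assms, of j] by (intro mult_left_le) auto
    then show "0 \<le> 1 - cmod (\<alpha> (Suc j)) \<and> 1 - cmod (\<alpha> (Suc j)) \<le> 1 - (cmod (\<alpha> (Suc j)))\<^sup>2"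
      using cls_lt_1[OF assms, of j] by (simp add: power2_eq_square)
  qed
  then show ?thesis using cls_prod_ge[OF assms, of n] by linarith
qed

text \<open>As (1 + x)(1 - x) <= 1, the lower bound 1/Q for one product becomes the upper bound Q
  for the other.\<close>

lemma cls_prod_plus_le:
  assumes "\<alpha> \<in> cls"
  shows "(\<Prod>j<n. 1 + cmod (\<alpha> (Suc j))) \<le> Q"
proof -
  have "(\<Prod>j<n. 1 + cmod (\<alpha> (Suc j))) * (1 / Q) \<le> (\<Prod>j<n. 1 + cmod (\<alpha> (Suc j))) * (\<Prod>j<n. 1 - cmod (\<alpha> (Suc j)))"
    by (intro mult_left_mono cls_prod_ge assms prod_nonneg) auto
  also have "\<dots> = (\<Prod>j<n. 1 - (cmod (\<alpha> (Suc j)))\<^sup>2)"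
    by (simp add: prod.distrib[symmetric] power2_eq_square algebra_simps)
  also have "\<dots> \<le> 1"
    using cls_lt_1[OF assms] by (intro prod_le_1) (auto simp: power_le_one less_imp_le)
  finally show ?thesis using Q by (simp add: field_simps)
qed

text \<open>The constant \<open>K\<close> is left free because for shifted sequences the decay holds
  with constants tending to 0, which gives the asymptotics of the shifted solutions.\<close>

lemma szego_limits:
  assumes \<alpha>: "\<alpha> \<in> cls" and z: "cmod z \<le> r" and r: "r \<ge> 1"
    and K: "\<And>n. r ^ n * cmod (\<alpha> (Suc n)) \<le> K * (1 / 2) ^ Suc n"
  shows "(\<lambda>n. szego_a n \<alpha> z) \<longlonglongrightarrow> jost_a \<alpha> z" "cmod (jost_a \<alpha> z - szego_a n \<alpha> z) \<le> Q * K * (1 / 2) ^ n"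
    and "(\<lambda>n. szego_b n \<alpha> z) \<longlonglongrightarrow> jost_b \<alpha> z" "cmod (jost_b \<alpha> z - szego_b n \<alpha> z) \<le> Q * K * (1 / 2) ^ n"
proof -
  have le: "(\<Prod>j<n. 1 + cmod (\<alpha> (Suc j))) * (r ^ n * cmod (\<alpha> (Suc n))) \<le> Q * K * (1 / 2) ^ Suc n" for n
  proof -
    have "(\<Prod>j<n. 1 + cmod (\<alpha> (Suc j))) * (r ^ n * cmod (\<alpha> (Suc n))) \<le> Q * (K * (1 / 2) ^ Suc n)"
      using Q r by (intro mult_mono K cls_prod_plus_le \<alpha>) auto
    then show ?thesis by (simp only: mult.assoc)
  qed
  have a: "cmod (szego_a (Suc n) \<alpha> z - szego_a n \<alpha> z) \<le> Q * K * (1 / 2) ^ Suc n"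
    and b: "cmod (szego_b (Suc n) \<alpha> z - szego_b n \<alpha> z) \<le> Q * K * (1 / 2) ^ Suc n" for n
    using szego_diff[OF z r, of n \<alpha>] le[of n] by (meson order_trans)+
  show "(\<lambda>n. szego_a n \<alpha> z) \<longlonglongrightarrow> jost_a \<alpha> z" "cmod (jost_a \<alpha> z - szego_a n \<alpha> z) \<le> Q * K * (1 / 2) ^ n"
    unfolding jost_a_def by (rule geometric_increments_limit[of "\<lambda>n. szego_a n \<alpha> z", OF a])+
  show "(\<lambda>n. szego_b n \<alpha> z) \<longlonglongrightarrow> jost_b \<alpha> z" "cmod (jost_b \<alpha> z - szego_b n \<alpha> z) \<le> Q * K * (1 / 2) ^ n"
    unfolding jost_b_def by (rule geometric_increments_limit[of "\<lambda>n. szego_b n \<alpha> z", OF b])+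
qed

lemma szego_tendsto:
  assumes "\<alpha> \<in> cls"
  shows "(\<lambda>n. szego_a n \<alpha> z) \<longlonglongrightarrow> jost_a \<alpha> z" "(\<lambda>n. szego_b n \<alpha> z) \<longlonglongrightarrow> jost_b \<alpha> z"
  using szego_limits(1,3)[OF assms _ _ cls_decay[OF assms], of z "max 1 (cmod z)"] by auto

lemma jost_norm_le:
  assumes "\<alpha> \<in> cls" "r \<ge> 1" "cmod z \<le> r"
  shows "cmod (jost_a \<alpha> z - 1) \<le> Q * decay_bound r" "cmod (jost_b \<alpha> z) \<le> Q * decay_bound r"
  using szego_limits(2,4)[OF assms(1,3,2) cls_decay[OF assms(1,2)], of 0] by auto

lemma jost_rec:
  assumes "\<alpha> \<in> cls"
  shows "jost_a \<alpha> z = jost_a (shift \<alpha>) z + \<alpha> (Suc 0) * z * jost_b (shift \<alpha>) z"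
    and "jost_b \<alpha> z = cnj (\<alpha> (Suc 0)) * jost_a (shift \<alpha>) z + z * jost_b (shift \<alpha>) z"
proof -
  note lims = szego_tendsto[OF assms, of z] szego_tendsto[OF cls_shift[OF assms], of z]
  have "(\<lambda>n. szego_a (Suc n) \<alpha> z) \<longlonglongrightarrow> jost_a (shift \<alpha>) z + \<alpha> (Suc 0) * z * jost_b (shift \<alpha>) z"
    unfolding szego_a.simps by (intro tendsto_intros lims)
  then show "jost_a \<alpha> z = jost_a (shift \<alpha>) z + \<alpha> (Suc 0) * z * jost_b (shift \<alpha>) z"
    using LIMSEQ_Suc[OF lims(1)] LIMSEQ_unique by blast
  have "(\<lambda>n. szego_b (Suc n) \<alpha> z) \<longlonglongrightarrow> cnj (\<alpha> (Suc 0)) * jost_a (shift \<alpha>) z + z * jost_b (shift \<alpha>) z"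
    unfolding szego_b.simps by (intro tendsto_intros lims)
  then show "jost_b \<alpha> z = cnj (\<alpha> (Suc 0)) * jost_a (shift \<alpha>) z + z * jost_b (shift \<alpha>) z"
    using LIMSEQ_Suc[OF lims(2)] LIMSEQ_unique by blast
qed

lemma jost_a_at_0: "\<alpha> \<in> cls \<Longrightarrow> jost_a \<alpha> 0 = 1"
  using szego_tendsto(1)[of \<alpha> 0] by (simp add: szego_at_0 LIMSEQ_const_iff)

lemma holomorphic_jost:
  assumes "\<alpha> \<in> cls"
  shows "jost_a \<alpha> holomorphic_on UNIV" "jost_b \<alpha> holomorphic_on UNIV"
proof -
  have *: "g holomorphic_on UNIV"
    if f: "\<And>n. f n holomorphic_on UNIV" and le: "\<And>n z r. r \<ge> 1 \<Longrightarrow> cmod z \<le> r \<Longrightarrow> cmod (g z - f n z) \<le> Q * decay_bound r * (1 / 2) ^ n"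
    for f :: "nat \<Rightarrow> complex \<Rightarrow> complex" and g
  proof (rule holomorphic_uniform_sequence[OF open_UNIV f])
    fix x :: complex
    define C where "C = Q * decay_bound (cmod x + 1)"
    have "uniform_limit (cball x 1) f g sequentially"
    proof (rule uniform_limitI)
      fix e :: real assume e: "e > 0"
      have "(\<lambda>n. C * (1 / 2) ^ n) \<longlonglongrightarrow> C * 0" by (intro tendsto_intros) auto
      then have "\<forall>\<^sub>F n in sequentially. C * (1 / 2) ^ n < e" using e by (auto dest: order_tendstoD)
      then show "\<forall>\<^sub>F n in sequentially. \<forall>y\<in>cball x 1. dist (f n y) (g y) < e"
      proof eventually_elim
        case (elim n)
        show ?case
        proof
          fix y assume "y \<in> cball x 1"
          then have "cmod y \<le> cmod x + 1"
            using norm_triangle_ineq2[of y x] by (simp add: dist_norm norm_minus_commute)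
          then have "cmod (g y - f n y) \<le> C * (1 / 2) ^ n" unfolding C_def by (intro le) auto
          then show "dist (f n y) (g y) < e" using elim by (simp add: dist_norm norm_minus_commute)
        qed
      qed
    qed
    then show "\<exists>d>0. cball x d \<subseteq> UNIV \<and> uniform_limit (cball x d) f g sequentially" by (auto intro!: exI[of _ 1])
  qed
  show "jost_a \<alpha> holomorphic_on UNIV"
    by (rule *[of "\<lambda>n. szego_a n \<alpha>"]) (use holomorphic_szego szego_limits(2)[OF assms _ _ cls_decay[OF assms]] in blast)+
  show "jost_b \<alpha> holomorphic_on UNIV"
    by (rule *[of "\<lambda>n. szego_b n \<alpha>"]) (use holomorphic_szego szego_limits(4)[OF assms _ _ cls_decay[OF assms]] in blast)+
qed

text \<open>The constant is the limit of the decreasing products of 1 - |\<alpha>_j|^2, which stay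
  above 1/Q.\<close>

lemma jost_reflection:
  assumes "\<alpha> \<in> cls"
  shows "\<exists>\<kappa>. 0 < \<kappa> \<and> \<kappa> \<le> 1 \<and> (\<forall>z. z \<noteq> 0 \<longrightarrow>
    jost_a \<alpha> z * cnj (jost_a \<alpha> (1 / cnj z)) - jost_b \<alpha> z * cnj (jost_b \<alpha> (1 / cnj z)) = of_real \<kappa>)"
proof -
  define p where "p n = (\<Prod>j<n. 1 - (cmod (\<alpha> (Suc j)))\<^sup>2)" for n
  have nn: "0 \<le> 1 - (cmod (\<alpha> (Suc j)))\<^sup>2" for j
    using cls_lt_1[OF assms, of j] by (simp add: power_le_one)
  have ge: "1 / Q \<le> p n" for n unfolding p_def by (rule cls_prod_square_ge[OF assms])
  have "decseq p"
    unfolding p_def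
    by (rule decseq_SucI, unfold prod.lessThan_Suc, rule mult_left_le) (use nn in \<open>auto intro!: prod_nonneg\<close>)
  then obtain \<kappa> where \<kappa>: "p \<longlonglongrightarrow> \<kappa>" "\<forall>n. \<kappa> \<le> p n"
    using decseq_convergent[of p "1 / Q"] ge by blast
  have "1 / Q \<le> \<kappa>" by (rule LIMSEQ_le_const[OF \<kappa>(1)]) (use ge in auto)
  then have "0 < \<kappa>" using Q by (smt (verit) divide_pos_pos)
  moreover have "\<kappa> \<le> 1" using \<kappa>(2)[rule_format, of 0] by (simp add: p_def)
  moreover have "jost_a \<alpha> z * cnj (jost_a \<alpha> (1 / cnj z)) - jost_b \<alpha> z * cnj (jost_b \<alpha> (1 / cnj z)) = of_real \<kappa>"
    if "z \<noteq> 0" for z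
  proof (rule LIMSEQ_unique)
    show "(\<lambda>n. of_real (p n) :: complex) \<longlonglongrightarrow> of_real \<kappa>" by (intro tendsto_intros \<kappa>)
    show "(\<lambda>n. of_real (p n)) \<longlonglongrightarrow> jost_a \<alpha> z * cnj (jost_a \<alpha> (1 / cnj z)) - jost_b \<alpha> z * cnj (jost_b \<alpha> (1 / cnj z))"
      unfolding p_def szego_reflection[OF that, symmetric] by (intro tendsto_intros szego_tendsto assms)
  qed
  ultimately show ?thesis by blast
qed

text \<open>The gap 1/Q between the squared moduli survives the limit.\<close>

lemma jost_Schur:
  assumes \<alpha>: "\<alpha> \<in> cls" and z: "cmod z \<le> 1"
  shows "cmod (jost_b \<alpha> z) \<le> cmod (jost_a \<alpha> z)" "jost_a \<alpha> z \<noteq> 0"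
proof -
  have lim: "(\<lambda>n. (cmod (szego_a n \<alpha> z))\<^sup>2 - (cmod (szego_b n \<alpha> z))\<^sup>2) \<longlonglongrightarrow> (cmod (jost_a \<alpha> z))\<^sup>2 - (cmod (jost_b \<alpha> z))\<^sup>2"
    by (intro tendsto_intros szego_tendsto \<alpha>)
  have ge: "1 / Q \<le> (cmod (szego_a n \<alpha> z))\<^sup>2 - (cmod (szego_b n \<alpha> z))\<^sup>2" for n
    using szego_Schur[OF z, of \<alpha> n] cls_lt_1[OF \<alpha>] cls_prod_square_ge[OF \<alpha>, of n]
    by (meson less_imp_le order_trans)
  have "1 / Q \<le> (cmod (jost_a \<alpha> z))\<^sup>2 - (cmod (jost_b \<alpha> z))\<^sup>2"
    by (rule LIMSEQ_le_const[OF lim]) (use ge in blast)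
  moreover have "1 / Q > 0" using Q by simp
  ultimately have *: "(cmod (jost_b \<alpha> z))\<^sup>2 < (cmod (jost_a \<alpha> z))\<^sup>2" by linarith
  then show "cmod (jost_b \<alpha> z) \<le> cmod (jost_a \<alpha> z)" using power2_le_imp_le less_imp_le norm_ge_zero by metis
  show "jost_a \<alpha> z \<noteq> 0" using * by (auto simp: power2_less_0)
qed

definition volterra_sol :: "(nat \<Rightarrow> complex) \<Rightarrow> complex \<Rightarrow> nat \<Rightarrow> complex^2" where
  "volterra_sol \<alpha> z k = vector [jost_a ((shift ^^ k) \<alpha>) z, - zeta z (Suc k) * jost_b ((shift ^^ k) \<alpha>) z]"

text \<open>Shifting by m improves the decay constant to \<open>C m\<close>, which contains 1 / r^m;
  this compensates the factor z^m.\<close>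

lemma shifted_jost_tail:
  assumes \<alpha>: "\<alpha> \<in> cls"
  shows "(\<lambda>m. jost_a ((shift ^^ m) \<alpha>) z) \<longlonglongrightarrow> 1" "(\<lambda>m. z ^ m * jost_b ((shift ^^ m) \<alpha>) z) \<longlonglongrightarrow> 0"
proof -
  define r where "r = max 1 (cmod z)"
  have r: "r \<ge> 1" "cmod z \<le> r" by (auto simp: r_def)
  define C where "C m = decay_bound r * (1 / 2) ^ m / r ^ m" for m
  have D0: "decay_bound r \<ge> 0" using \<eta> by (simp add: decay_bound_def)
  have "r ^ n * cmod ((shift ^^ m) \<alpha> (Suc n)) \<le> C m * (1 / 2) ^ Suc n" for m n
  proof -
    have "r ^ (m + n) * cmod (\<alpha> (Suc (m + n))) \<le> decay_bound r * (1 / 2) ^ Suc (m + n)"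
      by (rule cls_decay[OF \<alpha> r(1)])
    then show ?thesis using r by (simp add: C_def funpow_shift power_add field_simps)
  qed
  note * = szego_limits(2,4)[where n = 0, OF cls_funpow_shift[OF \<alpha>] r(2,1) this, simplified]
  have Cm: "Q * C m * r ^ m = Q * decay_bound r * (1 / 2) ^ m" "Q * C m \<le> Q * decay_bound r * (1 / 2) ^ m" for m
  proof -
    show 1: "Q * C m * r ^ m = Q * decay_bound r * (1 / 2) ^ m" using r by (simp add: C_def)
    have "Q * C m * 1 \<le> Q * C m * r ^ m" using Q D0 r by (intro mult_left_mono) (auto simp: C_def)
    then show "Q * C m \<le> Q * decay_bound r * (1 / 2) ^ m" using 1 by simp
  qed
  have lim: "(\<lambda>m. Q * decay_bound r * (1 / 2) ^ m) \<longlonglongrightarrow> 0"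
    by (intro tendsto_mult_right_zero LIMSEQ_power_zero) auto
  have "cmod (jost_a ((shift ^^ m) \<alpha>) z - 1) \<le> Q * decay_bound r * (1 / 2) ^ m" for m
    using *(1)[of m] Cm(2)[of m] by linarith
  then have "(\<lambda>m. jost_a ((shift ^^ m) \<alpha>) z - 1) \<longlonglongrightarrow> 0"
    by (intro Lim_null_comparison[OF _ lim] always_eventually) auto
  then show "(\<lambda>m. jost_a ((shift ^^ m) \<alpha>) z) \<longlonglongrightarrow> 1" by (simp add: LIM_zero_iff)
  have "cmod (z ^ m * jost_b ((shift ^^ m) \<alpha>) z) \<le> Q * decay_bound r * (1 / 2) ^ m" for m
  proof -
    have "cmod (z ^ m * jost_b ((shift ^^ m) \<alpha>) z) \<le> r ^ m * (Q * C m)"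
      unfolding norm_mult norm_power using r *(2) by (intro mult_mono power_mono) auto
    also have "\<dots> = Q * C m * r ^ m" by simp
    finally show ?thesis unfolding Cm(1) .
  qed
  then show "(\<lambda>m. z ^ m * jost_b ((shift ^^ m) \<alpha>) z) \<longlonglongrightarrow> 0"
    by (intro Lim_null_comparison[OF _ lim] always_eventually) auto
qed

text \<open>Both series telescope: the first sums increments of A, the second differences of z^j
  B_j. The boundary terms at infinity are the limits 1 and 0 from
  \<open>shifted_jost_tail\<close>.\<close>

lemma volterra_sol_sums:
  assumes \<alpha>: "\<alpha> \<in> cls"
  shows "(\<lambda>j. volterra_kernel \<alpha> z k (k + 1 + j) *v volterra_sol \<alpha> z (k + 1 + j)) sums (vector [1, 0] - volterra_sol \<alpha> z k)"
proof -
  define A where "A j = jost_a ((shift ^^ (k + j)) \<alpha>) z" for j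
  define B where "B j = jost_b ((shift ^^ (k + j)) \<alpha>) z" for j
  have eq: "(shift ^^ (k + j)) \<alpha> = (shift ^^ j) ((shift ^^ k) \<alpha>)" for j
    by (simp add: fun_eq_iff funpow_shift add_ac)
  have lim: "A \<longlonglongrightarrow> 1" "(\<lambda>j. z ^ j * B j) \<longlonglongrightarrow> 0"
    using shifted_jost_tail[OF cls_funpow_shift[OF \<alpha>, of k], of z] by (simp_all add: A_def[abs_def] B_def eq)
  have sh: "shift ((shift ^^ (k + j)) \<alpha>) = (shift ^^ (k + Suc j)) \<alpha>" for j by simp
  have rec: "A j = A (Suc j) + \<alpha> (Suc (k + j)) * z * B (Suc j)"
     "B j = cnj (\<alpha> (Suc (k + j))) * A (Suc j) + z * B (Suc j)" for j
    using jost_rec[OF cls_funpow_shift[OF \<alpha>, of "k + j"], of z] unfolding sh by (simp_all add: A_def B_def funpow_shift[where j = "Suc 0"])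
  have "(\<lambda>j. A (Suc j) - A j) sums (1 - A 0)" by (rule telescope_sums[OF lim(1)])
  moreover have "A (Suc j) - A j = \<alpha> (Suc (k + j)) * zeta z (Suc (k + j)) * (- zeta z (Suc (Suc (k + j))) * B (Suc j))" for j
    using rec(1)[of j] zeta_mult_zeta_Suc[of z "Suc (k + j)"] by (simp add: mult.assoc)
  ultimately have 1: "(\<lambda>j. \<alpha> (Suc (k + j)) * zeta z (Suc (k + j)) * (- zeta z (Suc (Suc (k + j))) * B (Suc j))) sums (1 - A 0)"
    by (simp only:)
  have "(\<lambda>j. zeta z (Suc k) * (z ^ j * B j - z ^ Suc j * B (Suc j))) sums (zeta z (Suc k) * (z ^ 0 * B 0 - 0))"
    by (intro sums_mult telescope_sums'[OF lim(2)])
  moreover have "zeta z (Suc k) * (z ^ j * B j - z ^ Suc j * B (Suc j)) = z ^ j * cnj (\<alpha> (Suc (k + j))) * zeta z (Suc k) * A (Suc j)" for j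
    unfolding rec(2)[of j] by (simp add: algebra_simps)
  ultimately have 2: "(\<lambda>j. z ^ j * cnj (\<alpha> (Suc (k + j))) * zeta z (Suc k) * A (Suc j)) sums (zeta z (Suc k) * B 0)"
    by (simp only: power_0 mult_1 diff_0_right)
  have "(\<lambda>j. volterra_kernel \<alpha> z k (k + 1 + j) *v volterra_sol \<alpha> z (k + 1 + j)) sums vector [1 - A 0, zeta z (Suc k) * B 0]"
    unfolding volterra_kernel_mult unfolding volterra_sol_def
    by (rule vec2_sums) (use 1 2 in \<open>simp_all add: A_def B_def\<close>)
  moreover have "vector [1 - A 0, zeta z (Suc k) * B 0] = vector [1, 0] - volterra_sol \<alpha> z k"
    by (simp add: vec_eq_iff forall_2 volterra_sol_def A_def B_def)
  ultimately show ?thesis by simp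
qed

lemma volterra_solution_volterra_sol:
  "\<alpha> \<in> cls \<Longrightarrow> volterra_solution \<alpha> z (volterra_sol \<alpha> z)"
  unfolding volterra_solution_def using volterra_sol_sums sums_iff by fastforce

text \<open>The difference of two solutions solves the homogeneous equations. Far out the kernel is
  so small that each equation halves a supremum bound, and the difference vanishes there; since each
  value depends only on later ones, it vanishes at all smaller indices too.\<close>

lemma volterra_solution_unique:
  assumes \<alpha>: "\<alpha> \<in> cls" and F: "volterra_solution \<alpha> z F" and F': "volterra_solution \<alpha> z F'"
  shows "F = F'"
proof -
  define d where "d i n = F n $ i - F' n $ i" for i n
  define r where "r = max 1 (cmod z)"
  have r: "r \<ge> 1" "cmod z \<le> r" by (auto simp: r_def)
  have sums: "(\<lambda>j. volterra_kernel \<alpha> z k (k + 1 + j) *v H (k + 1 + j)) sums (vector [1, 0] - H k)"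
    if "volterra_solution \<alpha> z H" for H :: "nat \<Rightarrow> complex^2" and k
  proof -
    have H: "H k = vector [1, 0] - (\<Sum>j. volterra_kernel \<alpha> z k (k + 1 + j) *v H (k + 1 + j))"
      and sm: "summable (\<lambda>j. volterra_kernel \<alpha> z k (k + 1 + j) *v H (k + 1 + j))"
      using that unfolding volterra_solution_def by blast+
    have "vector [1, 0] - H k = (\<Sum>j. volterra_kernel \<alpha> z k (k + 1 + j) *v H (k + 1 + j))"
      using H by (simp only: diff_diff_eq2 add_diff_cancel_left')
    then show ?thesis using summable_sums[OF sm] by (simp only:)
  qed
  have comp: "(\<lambda>j. \<alpha> (Suc (k + j)) * zeta z (Suc (k + j)) * H (Suc (k + j)) $ 2) sums (1 - H k $ 1)"
    "(\<lambda>j. z ^ j * cnj (\<alpha> (Suc (k + j))) * zeta z (Suc k) * H (Suc (k + j)) $ 1) sums (0 - H k $ 2)"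
    if "volterra_solution \<alpha> z H" for H :: "nat \<Rightarrow> complex^2" and k
    using sums_vec_nth[OF sums[OF that, of k, unfolded volterra_kernel_mult], of 1]
      sums_vec_nth[OF sums[OF that, of k, unfolded volterra_kernel_mult], of 2]
    unfolding vector_minus_component vector_2 by this
  have d1: "(\<lambda>j. \<alpha> (Suc (k + j)) * zeta z (Suc (k + j)) * d 2 (Suc (k + j))) sums (- d 1 k)" for k
    using sums_diff[OF comp(1)[OF F, of k] comp(1)[OF F', of k]] by (simp add: d_def right_diff_distrib)
  have d2: "(\<lambda>j. z ^ j * cnj (\<alpha> (Suc (k + j))) * zeta z (Suc k) * d 1 (Suc (k + j))) sums (- d 2 k)" for k
    using sums_diff[OF comp(2)[OF F, of k] comp(2)[OF F', of k]] by (simp add: d_def right_diff_distrib)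
  define D where "D = r * decay_bound r"
  have zr: "cmod (zeta z n) \<le> r" for n using r by (simp add: zeta_def)
  have w: "r * (r ^ j * cmod (\<alpha> (Suc (k + j)))) \<le> D * (1 / 2) ^ k * (1 / 2) ^ Suc j" for j k
  proof -
    have "r ^ j * cmod (\<alpha> (Suc (k + j))) \<le> r ^ (k + j) * cmod (\<alpha> (Suc (k + j)))"
      using r by (intro mult_right_mono power_increasing) auto
    also have "\<dots> \<le> decay_bound r * (1 / 2) ^ Suc (k + j)" by (rule cls_decay[OF \<alpha> r(1)])
    finally have "r * (r ^ j * cmod (\<alpha> (Suc (k + j)))) \<le> r * (decay_bound r * (1 / 2) ^ Suc (k + j))"
      using r by (intro mult_left_mono) auto
    then show ?thesis by (simp add: D_def power_add mult_ac)
  qed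
  have "(\<lambda>k. D * (1 / 2) ^ k) \<longlonglongrightarrow> 0" by (intro tendsto_mult_right_zero LIMSEQ_power_zero) auto
  then have "\<forall>\<^sub>F k in sequentially. D * (1 / 2) ^ k < 1 / 2" by (rule order_tendstoD) auto
  then obtain k0 where k0: "\<And>k. k \<ge> k0 \<Longrightarrow> D * (1 / 2) ^ k \<le> 1 / 2"
    unfolding eventually_sequentially by (meson less_imp_le)
  have step2: "cmod (d 2 k) \<le> 1 / 2 * M" if "k \<ge> k0" "\<And>n. n > k \<Longrightarrow> cmod (d 1 n) \<le> M" for k M
  proof -
    have M: "M \<ge> 0" using that(2)[of "Suc k"] norm_ge_zero order_trans by blast
    have le: "cmod (z ^ j * cnj (\<alpha> (Suc (k + j))) * zeta z (Suc k) * d 1 (Suc (k + j))) \<le> (D * (1 / 2) ^ k * M) * (1 / 2) ^ Suc j" for j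
    proof -
      have "cmod (z ^ j * cnj (\<alpha> (Suc (k + j))) * zeta z (Suc k) * d 1 (Suc (k + j))) \<le> r ^ j * cmod (\<alpha> (Suc (k + j))) * r * M"
        unfolding norm_mult norm_power complex_mod_cnj using r zr that(2) M by (intro mult_mono power_mono) auto
      also have "\<dots> = r * (r ^ j * cmod (\<alpha> (Suc (k + j)))) * M" by simp
      also have "\<dots> \<le> D * (1 / 2) ^ k * (1 / 2) ^ Suc j * M" by (intro mult_right_mono w M)
      finally show ?thesis by (simp add: mult_ac)
    qed
    have "cmod (- d 2 k) \<le> D * (1 / 2) ^ k * M"
      by (rule sums_geometric_bound[OF d2 le])
    also have "\<dots> \<le> 1 / 2 * M" using k0[OF that(1)] M by (intro mult_right_mono) auto
    finally show ?thesis by simp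
  qed
  have step1: "cmod (d 1 k) \<le> 1 / 2 * M" if "k \<ge> k0" "\<And>n. n > k \<Longrightarrow> cmod (d 2 n) \<le> M" for k M
  proof -
    have M: "M \<ge> 0" using that(2)[of "Suc k"] norm_ge_zero order_trans by blast
    have le: "cmod (\<alpha> (Suc (k + j)) * zeta z (Suc (k + j)) * d 2 (Suc (k + j))) \<le> (D * (1 / 2) ^ k * M) * (1 / 2) ^ Suc j" for j
    proof -
      have "cmod (\<alpha> (Suc (k + j)) * zeta z (Suc (k + j)) * d 2 (Suc (k + j))) \<le> cmod (\<alpha> (Suc (k + j))) * r * M"
        unfolding norm_mult using r zr that(2) M by (intro mult_mono) auto
      also have "\<dots> \<le> (r ^ j * cmod (\<alpha> (Suc (k + j)))) * r * M"
        using r M by (intro mult_right_mono) (auto simp: mult_le_cancel_right1)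
      also have "\<dots> = r * (r ^ j * cmod (\<alpha> (Suc (k + j)))) * M" by simp
      also have "\<dots> \<le> D * (1 / 2) ^ k * (1 / 2) ^ Suc j * M" by (intro mult_right_mono w M)
      finally show ?thesis by (simp add: mult_ac)
    qed
    have "cmod (- d 1 k) \<le> D * (1 / 2) ^ k * M"
      by (rule sums_geometric_bound[OF d1 le])
    also have "\<dots> \<le> 1 / 2 * M" using k0[OF that(1)] M by (intro mult_right_mono) auto
    finally show ?thesis by simp
  qed
  \<comment> \<open>A summable series has tails tending to \<open>0\<close>, so no growth condition on \<open>F\<close> is required.\<close>
  have "\<exists>M. \<forall>n\<ge>k0. cmod (d 1 n) \<le> M"
  proof -
    define f where "f n = \<alpha> (Suc n) * zeta z (Suc n) * d 2 (Suc n)" for n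
    have "summable f" using d1[of 0] by (auto simp: f_def[abs_def] sums_iff)
    have "- d 1 k = (\<Sum>j. f (j + k))" for k using d1[of k] by (simp add: f_def sums_iff add_ac)
    then have "(\<lambda>k. - d 1 k) \<longlonglongrightarrow> 0"
      using suminf_exist_split2[OF \<open>summable f\<close>] by presburger
    then have "Bseq (\<lambda>k. - d 1 k)" by (rule convergent_imp_Bseq[OF convergentI])
    then show ?thesis unfolding Bseq_def by auto
  qed
  then obtain M where M: "\<And>n. n \<ge> k0 \<Longrightarrow> cmod (d 1 n) \<le> M" by blast
  \<comment> \<open>One pass through both equations carries a bound for \<open>d 1\<close> to
    \<open>d 2\<close> and back, gaining 1/4.\<close>
  have iter: "\<forall>n\<ge>k0. cmod (d 1 n) \<le> (1 / 4) ^ m * M" for m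
  proof (induction m)
    case (Suc m)
    have 2: "cmod (d 2 n) \<le> 1 / 2 * ((1 / 4) ^ m * M)" if "n \<ge> k0" for n
      by (rule step2[OF that]) (use Suc that in auto)
    have "cmod (d 1 n) \<le> 1 / 2 * (1 / 2 * ((1 / 4) ^ m * M))" if "n \<ge> k0" for n
      by (rule step1[OF that]) (use 2 that in auto)
    then show ?case by simp
  qed (use M in simp)
  have z1: "d 1 n = 0" if "n \<ge> k0" for n
  proof -
    have "(\<lambda>m. (1 / 4) ^ m * M) \<longlonglongrightarrow> 0" by (intro tendsto_mult_left_zero LIMSEQ_power_zero) auto
    then have "cmod (d 1 n) \<le> 0" by (rule LIMSEQ_le_const) (use iter that in blast)
    then show ?thesis by simp
  qed
  have z2: "d 2 n = 0" if "n \<ge> k0" for n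
    using step2[of n 0] z1 that by auto
  have "d 1 n = 0 \<and> d 2 n = 0" for n
  proof (cases "n \<ge> k0")
    case False
    then have "n \<le> k0" by simp
    then have "\<forall>m\<ge>n. d 1 m = 0 \<and> d 2 m = 0"
    proof (induction rule: inc_induct)
      case (step n)
      have "d 1 n = 0" "d 2 n = 0" using d1[of n] d2[of n] step.IH by (simp_all add: sums_iff)
      then show ?case using step.IH by (metis le_antisym not_less_eq_eq)
    qed (use z1 z2 in auto)
    then show ?thesis by blast
  qed (use z1 z2 in auto)
  then show ?thesis by (simp add: d_def fun_eq_iff vec_eq_iff forall_2)
qed

lemma jost_solution_eq:
  "\<alpha> \<in> cls \<Longrightarrow> jost_solution \<alpha> z = volterra_sol \<alpha> z"
  unfolding jost_solution_def
  by (rule the_equality) (auto intro: volterra_solution_volterra_sol volterra_solution_unique)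

end

subsection \<open>Stability of the Verblunsky coefficients\<close>

text \<open>Over the common denominator the numerator splits into terms with a factor f - g or t - s
  (up to sign and conjugation), of total size 6 d; each of the two denominators is at least 1/Q.
  This is the origin of the growth factor 6 Q^2.\<close>

lemma Moebius_difference_le:
  fixes f g t s :: complex
  assumes fg: "cmod f \<le> 1" "cmod g \<le> 1" and d: "cmod (f - g) \<le> d" "cmod (t - s) \<le> d"
    and Q: "Q > 0" and ts: "1 / Q \<le> 1 - cmod t" "1 / Q \<le> 1 - cmod s"
  shows "cmod ((f - cnj t) / (1 - t * f) - (g - cnj s) / (1 - s * g)) \<le> 6 * Q\<^sup>2 * d"
proof -
  have den: "1 / Q \<le> cmod (1 - u * x)" if "1 / Q \<le> 1 - cmod u" "cmod x \<le> 1" for u x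
  proof -
    have "cmod (u * x) \<le> cmod u" using that by (simp add: norm_mult mult_left_le)
    moreover have "1 - cmod (u * x) \<le> cmod (1 - u * x)" using norm_triangle_ineq2[of 1 "u * x"] by simp
    ultimately show ?thesis using that by linarith
  qed
  note dt = den[OF ts(1) fg(1)] and ds = den[OF ts(2) fg(2)]
  have Q': "1 / Q > 0" using Q by simp
  then have nz: "1 - t * f \<noteq> 0" "1 - s * g \<noteq> 0" using dt ds by auto
  have le1: "cmod t \<le> 1" "cmod s \<le> 1" using ts Q' by linarith+
  define N where "N = (f - g) + cnj (s - t) + f * g * (t - s) + (cnj t * (s - t) + t * cnj (t - s)) * g + cnj s * t * (g - f)"
  have "(f - cnj t) / (1 - t * f) - (g - cnj s) / (1 - s * g) = N / ((1 - t * f) * (1 - s * g))"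
    using nz by (simp add: N_def diff_frac_eq) (simp add: algebra_simps)
  then have eq: "cmod ((f - cnj t) / (1 - t * f) - (g - cnj s) / (1 - s * g)) = cmod N / (cmod (1 - t * f) * cmod (1 - s * g))"
    by (simp add: norm_divide norm_mult)
  have d': "cmod (s - t) \<le> d" "cmod (g - f) \<le> d" using d by (simp_all add: norm_minus_commute)
  have d0: "d \<ge> 0" using d(1) norm_ge_zero order_trans by blast
  have "cmod (f * g * (t - s)) \<le> 1 * 1 * d"
    unfolding norm_mult using fg d by (intro mult_mono) auto
  moreover have "cmod ((cnj t * (s - t) + t * cnj (t - s)) * g) \<le> (1 * d + 1 * d) * 1"
  proof -
    have "cmod (cnj t * (s - t) + t * cnj (t - s)) \<le> cmod (cnj t) * cmod (s - t) + cmod t * cmod (cnj (t - s))"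
      using norm_triangle_ineq[of "cnj t * (s - t)" "t * cnj (t - s)"] by (simp only: norm_mult)
    also have "\<dots> \<le> 1 * d + 1 * d"
      unfolding complex_mod_cnj using d d' le1 by (intro add_mono mult_mono) auto
    finally show ?thesis unfolding norm_mult[of _ g] using fg d0 by (intro mult_mono) auto
  qed
  moreover have "cmod (cnj s * t * (g - f)) \<le> 1 * 1 * d"
    unfolding norm_mult complex_mod_cnj using le1 d' by (intro mult_mono) auto
  moreover have "cmod (cnj (s - t)) \<le> d" using d' by (simp only: complex_mod_cnj)
  moreover have "cmod (x1 + x2 + x3 + x4 + x5) \<le> cmod x1 + cmod x2 + cmod x3 + cmod x4 + cmod x5" for x1 x2 x3 x4 x5
    using norm_triangle_ineq[of x1 x2] norm_triangle_ineq[of "x1 + x2" x3]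
      norm_triangle_ineq[of "x1 + x2 + x3" x4] norm_triangle_ineq[of "x1 + x2 + x3 + x4" x5] by linarith
  ultimately have "cmod N \<le> d + d + 1 * 1 * d + (1 * d + 1 * d) * 1 + 1 * 1 * d"
    unfolding N_def using d(1) by (meson add_mono order_trans)
  then have "cmod N \<le> 6 * d" by simp
  moreover have "1 / Q * (1 / Q) \<le> cmod (1 - t * f) * cmod (1 - s * g)"
    using dt ds Q' by (intro mult_mono) auto
  ultimately have "cmod N / (cmod (1 - t * f) * cmod (1 - s * g)) \<le> 6 * d / (1 / Q * (1 / Q))"
    using Q' d0 by (intro frac_le) auto
  also have "\<dots> = 6 * Q\<^sup>2 * d" using Q by (simp add: power2_eq_square)
  finally show ?thesis unfolding eq .
qed

context verblunsky_decay
begin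

section \<open>The Jost function as a multiple of \<open>phi\<close>\<close>

definition phi :: "(nat \<Rightarrow> complex) \<Rightarrow> complex \<Rightarrow> complex" where
  "phi \<alpha> z = jost_a \<alpha> z + z * jost_b \<alpha> z"

lemma B0_subset_cls: "B0 \<gamma> \<eta> Q \<subseteq> cls"
proof
  fix \<alpha> assume \<alpha>: "\<alpha> \<in> B0 \<gamma> \<eta> Q"
  then have lt: "cmod (\<alpha> (Suc j)) < 1" and le: "cmod (\<alpha> (Suc j)) \<le> \<eta> * exp (- (real (Suc j) powr \<gamma>))" for j
    by (auto simp: B0_def verblunsky_seq_def)
  \<comment> \<open>Summability makes the infinite product converge, so that its value is the limit
    of the decreasing partial products and not a default.\<close>
  have "summable (\<lambda>j. cmod (\<alpha> (Suc j)))"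
  proof (rule summable_comparison_test')
    have "summable (\<lambda>j. decay_bound 1 * (1 / 2) ^ j :: real)"
      by (intro summable_mult summable_geometric) auto
    then show "summable (\<lambda>j. decay_bound 1 * (1 / 2) ^ Suc j)" by (subst summable_Suc_iff)
    show "norm (cmod (\<alpha> (Suc j))) \<le> decay_bound 1 * (1 / 2) ^ Suc j" for j
      using le[of j] weight_le[of 1 j] by simp
  qed
  then have "abs_convergent_prod (\<lambda>j. 1 - cmod (\<alpha> (Suc j)))"
    by (intro summable_imp_abs_convergent_prod) simp
  then have "convergent_prod (\<lambda>j. 1 - cmod (\<alpha> (Suc j)))" by (rule abs_convergent_prod_imp_convergent_prod)
  then have lim: "(\<lambda>n. \<Prod>j\<le>n. 1 - cmod (\<alpha> (Suc j))) \<longlonglongrightarrow> (\<Prod>j. 1 - cmod (\<alpha> (Suc j)))"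
    by (rule convergent_prod_LIMSEQ)
  have "decseq (\<lambda>n. \<Prod>j\<le>n. 1 - cmod (\<alpha> (Suc j)))"
    by (rule decseq_SucI, unfold prod.atMost_Suc, rule mult_left_le)
       (use lt in \<open>auto intro!: prod_nonneg simp: less_imp_le\<close>)
  then have "(\<Prod>j. 1 - cmod (\<alpha> (Suc j))) \<le> (\<Prod>j\<le>n. 1 - cmod (\<alpha> (Suc j)))" for n
    using lim by (rule decseq_ge)
  moreover have "1 / Q \<le> (\<Prod>j. 1 - cmod (\<alpha> (Suc j)))" using \<alpha> by (simp add: B0_def)
  ultimately have ge: "1 / Q \<le> (\<Prod>j\<le>n. 1 - cmod (\<alpha> (Suc j)))" for n using order_trans by blast
  have "1 / Q \<le> (\<Prod>j<n. 1 - cmod (\<alpha> (Suc j)))" for n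
    using ge[of "n - 1"] Q by (cases n) (auto simp: lessThan_Suc_atMost)
  then show "\<alpha> \<in> cls" using \<alpha> by (simp add: decay_class_def B0_def verblunsky_seq_def)
qed

text \<open>Since 1 - |\<alpha>_j| <= \<rho>_j <= 1, the partial products of the normalising
  constant stay between 1 and Q. The operator determines the coefficients at positive indices, and
  only these enter the Volterra equations.\<close>

lemma jost_function_cmv:
  assumes \<alpha>: "\<alpha> \<in> cls"
  obtains c where "c \<noteq> 0" "jost_function (cmv \<alpha>) = (\<lambda>z. c * phi \<alpha> z)"
proof -
  define C where "C = (\<Prod>j. inverse (rho \<alpha> (Suc j)))"
  have vs: "verblunsky_seq \<alpha>" using \<alpha> by (auto simp: decay_class_def verblunsky_seq_def)
  have rho: "1 - cmod (\<alpha> (Suc j)) \<le> rho \<alpha> (Suc j)" "rho \<alpha> (Suc j) \<le> 1" "0 < 1 - cmod (\<alpha> (Suc j))" for j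
  proof -
    define x where "x = cmod (\<alpha> (Suc j))"
    have x: "0 \<le> x" "x < 1" using cls_lt_1[OF \<alpha>, of j] by (auto simp: x_def)
    have "(1 - x)\<^sup>2 \<le> 1 - x\<^sup>2"
      using mult_left_mono[of x 1 x] x by (simp add: power2_eq_square algebra_simps)
    then show "1 - cmod (\<alpha> (Suc j)) \<le> rho \<alpha> (Suc j)"
      unfolding rho_def x_def[symmetric] by (rule real_le_rsqrt)
    show "rho \<alpha> (Suc j) \<le> 1" unfolding rho_def by simp
    show "0 < 1 - cmod (\<alpha> (Suc j))" using x by (simp add: x_def)
  qed
  have rho_pos: "0 < rho \<alpha> (Suc j)" for j using rho(1,3)[of j] by (rule less_le_trans[rotated])
  have "convergent_prod (\<lambda>j. inverse (rho \<alpha> (Suc j)))"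
  proof (rule bounded_imp_convergent_prod)
    show "1 \<le> inverse (rho \<alpha> (Suc n))" for n
      using rho(2) rho_pos by (intro one_le_inverse)
    show "(\<Prod>j\<le>n. inverse (rho \<alpha> (Suc j))) \<le> Q" for n
    proof -
      have "(\<Prod>j\<le>n. inverse (rho \<alpha> (Suc j))) \<le> (\<Prod>j<Suc n. inverse (1 - cmod (\<alpha> (Suc j))))"
        unfolding lessThan_Suc_atMost using rho rho_pos
        by (intro prod_mono) (auto intro!: le_imp_inverse_le simp: less_imp_le)
      also have "\<dots> = inverse (\<Prod>j<Suc n. 1 - cmod (\<alpha> (Suc j)))" by (simp only: prod_inversef[symmetric] o_def)
      also have "\<dots> \<le> inverse (1 / Q)"
        using cls_prod_ge[OF \<alpha>, of "Suc n"] Q by (intro le_imp_inverse_le) auto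
      finally show ?thesis by simp
    qed
  qed
  then have "C \<noteq> 0"
    unfolding C_def by (rule prodinf_nonzero) (use rho_pos less_irrefl in \<open>auto simp: less_le\<close>)
  have ver: "verblunsky (cmv \<alpha>) (Suc n) = \<alpha> (Suc n)" for n
    using verblunsky_cmv[OF vs] by simp
  have "volterra_solution (verblunsky (cmv \<alpha>)) = volterra_solution \<alpha>"
    unfolding volterra_solution_def[abs_def] volterra_kernel_def by (simp add: ver)
  then have js: "jost_solution (verblunsky (cmv \<alpha>)) z = volterra_sol \<alpha> z" for z
    unfolding jost_solution_eq[OF \<alpha>, symmetric] by (simp add: jost_solution_def)
  have "jost_function (cmv \<alpha>) z = of_real C * phi \<alpha> z" for z
    unfolding jost_function_def Let_def js
    by (simp add: rho_def ver C_def volterra_sol_def phi_def zeta_def)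
  then show ?thesis using that[of "of_real C"] \<open>C \<noteq> 0\<close> by auto
qed

lemma holomorphic_phi: "\<alpha> \<in> cls \<Longrightarrow> phi \<alpha> holomorphic_on UNIV"
  unfolding phi_def[abs_def] by (intro holomorphic_intros holomorphic_jost)

lemma resonance_iff: "\<alpha> \<in> cls \<Longrightarrow> resonance (cmv \<alpha>) z \<longleftrightarrow> phi \<alpha> z = 0"
  using jost_function_cmv[of \<alpha>] unfolding resonance_def by (metis mult_eq_0_iff)

lemma resonance_mult_eq:
  assumes \<alpha>: "\<alpha> \<in> cls"
  shows "resonance_mult (cmv \<alpha>) z = (if phi \<alpha> z = 0 then nat (zorder (phi \<alpha>) z) else 0)"
proof -
  obtain c where c: "c \<noteq> 0" "jost_function (cmv \<alpha>) = (\<lambda>z. c * phi \<alpha> z)"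
    by (rule jost_function_cmv[OF \<alpha>])
  have "zorder (jost_function (cmv \<alpha>)) z = zorder (phi \<alpha>) z"
    unfolding c(2) by (rule zorder_cmult[OF c(1)])
  then show ?thesis by (simp add: resonance_mult_def resonance_iff[OF \<alpha>])
qed

section \<open>Growth of \<open>phi\<close>\<close>

abbreviation growth_exponent :: real where
  "growth_exponent \<equiv> \<gamma> / (\<gamma> - 1)"

text \<open>The leading 1 covers \<open>ln 2\<close>; of the two copies of the power, one is the
  exponent in \<open>decay_bound\<close> and one absorbs \<open>ln t\<close>.\<close>

definition log_growth :: "real \<Rightarrow> real" where
  "log_growth t = 1 + ln (1 + Q * \<eta>) + 2 * (ln t + 1) powr growth_exponent"

lemma growth_exponent_gt_1: "growth_exponent > 1"
  using \<gamma> by simp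

lemma phi_growth:
  assumes \<alpha>: "\<alpha> \<in> cls" and t: "t \<ge> 1" and z: "cmod z \<le> t"
  shows "cmod (phi \<alpha> z) \<le> exp (log_growth t)"
proof -
  define E where "E = (ln t + 1) powr growth_exponent"
  have L: "ln t + 1 \<ge> 1" using t by simp
  have E: "ln t \<le> E" "E \<ge> 0"
    using powr_mono[of 1 growth_exponent "ln t + 1"] L growth_exponent_gt_1 by (auto simp: E_def)
  have QD: "Q * decay_bound t = Q * \<eta> * exp E" by (simp add: decay_bound_def E_def)
  have "cmod (phi \<alpha> z) \<le> cmod (jost_a \<alpha> z - 1) + 1 + cmod z * cmod (jost_b \<alpha> z)"
  proof -
    have "phi \<alpha> z = (jost_a \<alpha> z - 1) + 1 + z * jost_b \<alpha> z" by (simp add: phi_def)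
    then show ?thesis by (metis norm_mult norm_one norm_triangle_le norm_triangle_ineq add_right_mono)
  qed
  also have "\<dots> \<le> Q * decay_bound t + 1 + t * (Q * decay_bound t)"
    using z t by (intro add_mono mult_mono jost_norm_le[OF \<alpha> t z] order_refl) auto
  also have "\<dots> \<le> 2 * t * (1 + Q * \<eta>) * exp E"
  proof -
    have "1 + Q * decay_bound t \<le> (1 + Q * \<eta>) * exp E" unfolding QD using E by (simp add: algebra_simps)
    then have "(1 + t) * (1 + Q * decay_bound t) \<le> (2 * t) * ((1 + Q * \<eta>) * exp E)"
      using t Q \<eta> QD by (intro mult_mono) auto
    moreover have "Q * decay_bound t + 1 + t * (Q * decay_bound t) \<le> (1 + t) * (1 + Q * decay_bound t)"
      using t by (simp add: algebra_simps)
    ultimately show ?thesis by (simp add: mult.assoc)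
  qed
  also have "\<dots> = exp (ln 2 + ln t + ln (1 + Q * \<eta>) + E)"
    using t Q \<eta> by (simp add: exp_add add_pos_pos)
  also have "\<dots> \<le> exp (log_growth t)"
    using ln_2_less_1 E by (simp add: log_growth_def E_def)
  finally show ?thesis .
qed

lemma ln_one_plus_nonneg: "0 \<le> ln (1 + Q * \<eta>)"
  using Q \<eta> by simp

lemma log_growth_linear: "\<exists>C. \<forall>t\<ge>1. log_growth (3 * t) \<le> C * t"
proof -
  define p where "p = growth_exponent"
  define c where "c = 1 + ln (1 + Q * \<eta>)"
  have c: "c \<ge> 0" using ln_one_plus_nonneg by (simp add: c_def)
  have p: "p > 1" using growth_exponent_gt_1 by (simp add: p_def)
  have "log_growth (3 * t) \<le> (c + 6 * exp (1 + p * ln p)) * t" if t: "t \<ge> 1" for t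
  proof -
    define y where "y = ln (3 * t) + 1"
    have y: "y \<ge> 1" using t by (simp add: y_def)
    \<comment> \<open>The tangent of ln at p bounds y^p by a multiple of exp y, which is linear in t
      because y = ln (3t) + 1.\<close>
    have "ln y - ln p \<le> (y - p) / p" by (rule ln_diff_le) (use y p in auto)
    then have "p * (ln y - ln p) \<le> p * ((y - p) / p)" using p by (intro mult_left_mono) auto
    moreover have "p * ((y - p) / p) = y - p" using p by simp
    ultimately have "p * ln y \<le> y + p * ln p" using p by (simp add: right_diff_distrib)
    then have "y powr p \<le> exp (y + p * ln p)" using y by (simp add: powr_def)
    also have "\<dots> = 3 * exp (1 + p * ln p) * t" using t by (simp add: y_def exp_add)
    finally have "2 * y powr p \<le> 6 * exp (1 + p * ln p) * t" by linarith
    moreover have "c \<le> c * t" using c t mult_left_mono[of 1 t c] by simp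
    ultimately have "c + 2 * y powr p \<le> (c + 6 * exp (1 + p * ln p)) * t"
      unfolding distrib_right by (rule add_mono[rotated])
    then show ?thesis by (simp add: log_growth_def c_def p_def y_def)
  qed
  then show ?thesis by blast
qed

lemma log_growth_le_ln_powr: "\<exists>C\<ge>0. \<forall>R\<ge>4. log_growth (3 * R) + 1 \<le> C * ln R powr growth_exponent"
proof -
  define p where "p = growth_exponent"
  define c where "c = 2 + ln (1 + Q * \<eta>)"
  have c: "c \<ge> 0" using ln_one_plus_nonneg by (simp add: c_def)
  have p: "p > 1" using growth_exponent_gt_1 by (simp add: p_def)
  have "log_growth (3 * R) + 1 \<le> (c + 2 * 4 powr p) * ln R powr p" if R: "R \<ge> 4" for R
  proof -
    \<comment> \<open>The point of R >= 4 is that ln R >= 1, so additive constants are absorbed into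
      powers of ln R.\<close>
    have "ln (exp 1) \<le> ln R" by (subst ln_le_cancel_iff) (use R exp_le in auto)
    then have l: "ln R \<ge> 1" by simp
    have "ln (3::real) \<le> 2" using ln_le_minus_one[of 3] by simp
    then have "ln (3 * R) + 1 \<le> 4 * ln R" using R l by (simp add: ln_mult)
    then have "(ln (3 * R) + 1) powr p \<le> (4 * ln R) powr p" using R p by (intro powr_mono2) auto
    also have "\<dots> = 4 powr p * ln R powr p" using l by (simp add: powr_mult)
    finally have 1: "2 * (ln (3 * R) + 1) powr p \<le> 2 * 4 powr p * ln R powr p" by simp
    have "1 \<le> ln R powr p" using l p by (intro ge_one_powr_ge_zero) auto
    then have "c \<le> c * ln R powr p" using c mult_left_mono[of 1 "ln R powr p" c] by simp
    then show ?thesis using 1 by (simp add: log_growth_def c_def p_def[symmetric] distrib_right)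
  qed
  moreover have "c + 2 * 4 powr p \<ge> 0" using c by (simp add: add_nonneg_nonneg)
  ultimately show ?thesis unfolding p_def by blast
qed

section \<open>Schur functions and the Schur algorithm\<close>

lemma holomorphic_Schur:
  "\<alpha> \<in> cls \<Longrightarrow> (\<lambda>z. jost_b \<alpha> z / jost_a \<alpha> z) holomorphic_on cball 0 1"
  by (intro holomorphic_on_divide holomorphic_on_subset[OF holomorphic_jost(1)]
      holomorphic_on_subset[OF holomorphic_jost(2)]) (auto simp: jost_Schur)

lemma Schur_at_0: "\<alpha> \<in> cls \<Longrightarrow> jost_b \<alpha> 0 / jost_a \<alpha> 0 = cnj (\<alpha> (Suc 0))"
  using jost_rec(2)[of \<alpha> 0] by (simp add: jost_a_at_0 cls_shift)

lemma norm_Schur_le: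
  assumes "\<alpha> \<in> cls" "cmod z \<le> 1"
  shows "cmod (jost_b \<alpha> z / jost_a \<alpha> z) \<le> 1"
  using jost_Schur[OF assms] by (simp add: norm_divide divide_le_eq_1)

text \<open>Solving the recursion for the shifted pair produces 1 - |t|^2 in numerator and
  denominator; it cancels and leaves the classical Schur step.\<close>

lemma Schur_step:
  assumes \<alpha>: "\<alpha> \<in> cls" and z: "cmod z \<le> 1"
  shows "z * (jost_b (shift \<alpha>) z / jost_a (shift \<alpha>) z) =
    (jost_b \<alpha> z / jost_a \<alpha> z - cnj (\<alpha> (Suc 0))) / (1 - \<alpha> (Suc 0) * (jost_b \<alpha> z / jost_a \<alpha> z))"
proof -
  define t where "t = \<alpha> (Suc 0)"
  define a where "a = jost_a \<alpha> z"
  define b where "b = jost_b \<alpha> z"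
  define a1 where "a1 = jost_a (shift \<alpha>) z"
  define b1 where "b1 = jost_b (shift \<alpha>) z"
  have nz: "a \<noteq> 0" "a1 \<noteq> 0"
    using jost_Schur(2)[OF \<alpha> z] jost_Schur(2)[OF cls_shift[OF \<alpha>] z] by (auto simp: a_def a1_def)
  have t: "1 - t * cnj t \<noteq> 0"
  proof
    assume "1 - t * cnj t = 0"
    then have "of_real ((cmod t)\<^sup>2) = (1 :: complex)" by (simp only: complex_norm_square right_minus_eq)
    then have "(cmod t)\<^sup>2 = 1" by (simp only: of_real_eq_1_iff)
    then show False using cls_lt_1[OF \<alpha>, of 0] norm_ge_zero[of t] by (auto simp: t_def power2_eq_1_iff)
  qed
  have rec: "a = a1 + t * z * b1" "b = cnj t * a1 + z * b1"
    using jost_rec[OF \<alpha>, of z] by (simp_all add: a_def b_def a1_def b1_def t_def)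
  have 1: "b - cnj t * a = z * b1 * (1 - t * cnj t)" "a - t * b = a1 * (1 - t * cnj t)"
    unfolding rec by (simp_all add: algebra_simps)
  have "(b / a - cnj t) / (1 - t * (b / a)) = (b - cnj t * a) / (a - t * b)"
    using nz by (simp add: divide_simps)
  also have "\<dots> = z * (b1 / a1)" unfolding 1 using t by simp
  finally show ?thesis by (simp add: a_def b_def a1_def b1_def t_def)
qed

lemma first_coefficient_difference:
  assumes \<alpha>: "\<alpha> \<in> cls" "\<alpha>' \<in> cls"
    and d: "\<And>z. cmod z = 1 \<Longrightarrow> cmod (jost_b \<alpha> z / jost_a \<alpha> z - jost_b \<alpha>' z / jost_a \<alpha>' z) \<le> d"
  shows "cmod (\<alpha> (Suc 0) - \<alpha>' (Suc 0)) \<le> d"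
proof -
  define h where "h z = jost_b \<alpha> z / jost_a \<alpha> z - jost_b \<alpha>' z / jost_a \<alpha>' z" for z
  have hol: "h holomorphic_on cball 0 1"
    unfolding h_def by (intro holomorphic_intros holomorphic_Schur \<alpha>)
  have "cmod (h 0) \<le> d"
    by (rule maximum_modulus_frontier[of h "cball 0 1"])
       (use d hol in \<open>auto simp: h_def[symmetric] intro: holomorphic_on_subset holomorphic_on_imp_continuous_on\<close>)
  also have "h 0 = cnj (\<alpha> (Suc 0) - \<alpha>' (Suc 0))" using \<alpha> by (simp only: h_def Schur_at_0 complex_cnj_diff)
  finally show ?thesis by (simp only: complex_mod_cnj)
qed

text \<open>A bound d on the circle controls the Schur functions and, through their values at 0, the
  first coefficients, as the Moebius estimate requires. The factor z of the Schur step costs nothing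
  on the circle, so the shifted pair satisfies the bound 6 Q^2 d.\<close>

lemma Schur_algorithm_stability:
  assumes "\<alpha> \<in> cls" "\<alpha>' \<in> cls"
    and "\<And>z. cmod z = 1 \<Longrightarrow> cmod (jost_b \<alpha> z / jost_a \<alpha> z - jost_b \<alpha>' z / jost_a \<alpha>' z) \<le> d"
  shows "cmod (\<alpha> (Suc n) - \<alpha>' (Suc n)) \<le> (6 * Q\<^sup>2) ^ n * d"
  using assms
proof (induction n arbitrary: \<alpha> \<alpha>' d)
  case (0 \<alpha> \<alpha>' d)
  then show ?case using first_coefficient_difference by simp
next
  case (Suc n \<alpha> \<alpha>' d)
  have "cmod (jost_b (shift \<alpha>) z / jost_a (shift \<alpha>) z - jost_b (shift \<alpha>') z / jost_a (shift \<alpha>') z) \<le> 6 * Q\<^sup>2 * d"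
    if z: "cmod z = 1" for z
  proof -
    have "cmod (z * (jost_b (shift \<alpha>) z / jost_a (shift \<alpha>) z) - z * (jost_b (shift \<alpha>') z / jost_a (shift \<alpha>') z)) \<le> 6 * Q\<^sup>2 * d"
      unfolding Schur_step[OF Suc.prems(1) eq_refl[OF z]] Schur_step[OF Suc.prems(2) eq_refl[OF z]]
      using Q z by (intro Moebius_difference_le norm_Schur_le Suc.prems cls_one_minus_ge first_coefficient_difference) auto
    then show ?thesis unfolding right_diff_distrib[symmetric] norm_mult z by simp
  qed
  then have "cmod (shift \<alpha> (Suc n) - shift \<alpha>' (Suc n)) \<le> (6 * Q\<^sup>2) ^ n * (6 * Q\<^sup>2 * d)"
    by (intro Suc.IH cls_shift Suc.prems)
  then show ?case by (simp add: shift_apply mult_ac)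
qed

section \<open>Uniform stability for a fixed zero-free radius\<close>

lemma stability_zero_free:
  assumes \<delta>: "0 < \<delta>" "\<delta> \<le> 1"
  shows "\<exists>K>0. \<forall>\<alpha>\<in>cls. \<forall>\<alpha>'\<in>cls. \<forall>R \<epsilon>.
    (\<forall>z. cmod z < 1 + \<delta> \<longrightarrow> phi \<alpha> z \<noteq> 0 \<and> phi \<alpha>' z \<noteq> 0) \<longrightarrow> R \<ge> 4 \<longrightarrow> \<epsilon> > 0 \<longrightarrow>
    resonances_respectively_close \<epsilon> R (cmv \<alpha>) (cmv \<alpha>') \<longrightarrow>
    (\<forall>n. cmod (\<alpha> (Suc n) - \<alpha>' (Suc n)) \<le> K * (6 * Q\<^sup>2) ^ n * (\<epsilon> + ln R powr growth_exponent / R))"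
proof -
  obtain C where C: "\<And>t. t \<ge> 1 \<Longrightarrow> log_growth (3 * t) \<le> C * t"
    using log_growth_linear by blast
  obtain C2 where C2: "C2 \<ge> 0" "\<And>R. R \<ge> 4 \<Longrightarrow> log_growth (3 * R) + 1 \<le> C2 * ln R powr growth_exponent"
    using log_growth_le_ln_powr by blast
  have "0 \<le> log_growth 3"
    unfolding log_growth_def using ln_one_plus_nonneg by (intro add_nonneg_nonneg) auto
  then have C0: "C \<ge> 0" using C[of 1] by simp
  \<comment> \<open>exp (- B) bounds |phi| from below near the unit disk, by its growth on |z| < 1 +
    \<delta> <= 2. \<open>K1\<close> collects the terms of the ratio estimate; in \<open>K2\<close>,
    2 K1 err is the \<theta> of the Caratheodory estimate, and the leading 2 comes from passing to
    Schur functions.\<close>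
  define B where "B = 4 * (log_growth 2 + 1) / \<delta>"
  define K1 where "K1 = 64 * C / \<delta> + 8 * C2 + 1"
  define K2 where "K2 = 2 * (120 * exp (2 * B) / \<delta>) * (2 * K1)"
  have K1: "K1 > 0" using C0 C2(1) \<delta> by (simp add: K1_def add_nonneg_pos)
  have K2: "K2 > 0" using K1 \<delta> by (simp add: K2_def)
  have "1 \<le> Q\<^sup>2" using Q by (intro one_le_power) simp
  then have Q6: "1 \<le> (6 * Q\<^sup>2) ^ n" for n by (intro one_le_power) simp
  have main: "cmod (\<alpha> (Suc n) - \<alpha>' (Suc n)) \<le> (8 * K1 + K2) * (6 * Q\<^sup>2) ^ n * (\<epsilon> + ln R powr growth_exponent / R)"
    if \<alpha>: "\<alpha> \<in> cls" "\<alpha>' \<in> cls" and nz: "\<And>z. cmod z < 1 + \<delta> \<Longrightarrow> phi \<alpha> z \<noteq> 0 \<and> phi \<alpha>' z \<noteq> 0"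
      and R: "R \<ge> 4" and \<epsilon>: "\<epsilon> > 0" and close: "resonances_respectively_close \<epsilon> R (cmv \<alpha>) (cmv \<alpha>')"
    for \<alpha> \<alpha>' R \<epsilon> n
  proof -
    define err where "err = \<epsilon> + ln R powr growth_exponent / R"
    have err0: "err > 0" using \<epsilon> R by (simp add: err_def add_pos_nonneg)
    show ?thesis
    proof (cases "K1 * err \<le> 1 / 4")
      \<comment> \<open>If the error is not small, the trivial bound 2 is already below 8 K1
        err.\<close>
      case False
      have "cmod (\<alpha> (Suc n) - \<alpha>' (Suc n)) \<le> 1 + 1"
        using cls_lt_1[OF \<alpha>(1), of n] cls_lt_1[OF \<alpha>(2), of n]
        by (intro order_trans[OF norm_triangle_ineq4] add_mono) auto
      also have "\<dots> \<le> 8 * K1 * err" using False by simp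
      also have "\<dots> \<le> (8 * K1 + K2) * err" using K2 err0 by (intro mult_right_mono) auto
      also have "\<dots> \<le> (8 * K1 + K2) * err * (6 * Q\<^sup>2) ^ n"
        using mult_left_mono[OF Q6[of n], of "(8 * K1 + K2) * err"] K1 K2 err0 by simp
      finally show ?thesis by (simp add: err_def[symmetric] mult_ac)
    next
      case small: True
      obtain zs ws where zw: "lists_resonances (cmv \<alpha>) R zs" "lists_resonances (cmv \<alpha>') R ws"
        "list_all2 (\<lambda>z w. cmod (z - w) < \<epsilon>) zs ws"
        using close unfolding resonances_respectively_close_def by blast
      have zs: "count_list zs z = (if cmod z < R \<and> phi \<alpha> z = 0 then nat (zorder (phi \<alpha>) z) else 0)" for z
        using zw(1) unfolding lists_resonances_def resonance_mult_eq[OF \<alpha>(1)] by simp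
      have ws: "count_list ws z = (if cmod z < R \<and> phi \<alpha>' z = 0 then nat (zorder (phi \<alpha>') z) else 0)" for z
        using zw(2) unfolding lists_resonances_def resonance_mult_eq[OF \<alpha>(2)] by simp
      have phi0: "phi \<alpha> 0 = 1" "phi \<alpha>' 0 = 1" using \<alpha> by (simp_all add: phi_def jost_a_at_0)
      \<comment> \<open>The factor 2 comes from exp x - 1 <= x + x^2 <= 2x for 0 <= x <= 1;
        smallness of K1 err gives \<theta> <= 1/2.\<close>
      define \<theta> where "\<theta> = 2 * (K1 * err)"
      have near: "cmod (phi \<alpha> x / phi \<alpha>' x - 1) \<le> \<theta>" if x: "cmod x \<le> 1 + \<delta> / 4" for x
      proof -
        have "cmod (phi \<alpha> x / phi \<alpha>' x - 1) \<le> exp (64 * C / \<delta> * \<epsilon> + 8 * (log_growth (3 * R) + 1) / R) - 1"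
          by (rule entire_ratio_bound[OF holomorphic_phi[OF \<alpha>(1)] holomorphic_phi[OF \<alpha>(2)] phi0
              phi_growth[OF \<alpha>(1)] phi_growth[OF \<alpha>(2)] C zs ws zw(3) \<epsilon> _ _ \<delta> R x]) (use nz in auto)
        also have "64 * C / \<delta> * \<epsilon> + 8 * (log_growth (3 * R) + 1) / R \<le> K1 * err"
        proof -
          have "8 * (log_growth (3 * R) + 1) / R \<le> 8 * (C2 * ln R powr growth_exponent) / R"
            using C2(2)[OF R] R by (intro divide_right_mono mult_left_mono) auto
          also have "\<dots> = 8 * C2 * (ln R powr growth_exponent / R)" by simp
          also have "\<dots> \<le> K1 * (ln R powr growth_exponent / R)"
            using C0 \<delta> R by (intro mult_right_mono) (auto simp: K1_def)
          finally have "8 * (log_growth (3 * R) + 1) / R \<le> K1 * (ln R powr growth_exponent / R)" .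
          moreover have "64 * C / \<delta> * \<epsilon> \<le> K1 * \<epsilon>"
            using C2(1) \<epsilon> by (intro mult_right_mono) (auto simp: K1_def)
          ultimately show ?thesis by (simp add: err_def distrib_left)
        qed
        also have "exp (K1 * err) - 1 \<le> \<theta>"
        proof -
          have "exp (K1 * err) \<le> 1 + K1 * err + (K1 * err)\<^sup>2"
            using small K1 err0 by (intro exp_bound) auto
          moreover have "(K1 * err)\<^sup>2 \<le> K1 * err"
            unfolding power2_eq_square using small K1 err0 by (intro mult_left_le) auto
          ultimately show ?thesis by (simp add: \<theta>_def)
        qed
        finally show ?thesis by simp
      qed
      have lb: "exp (- B) \<le> cmod (phi \<alpha> x)" if x: "cmod x \<le> 1 + \<delta> / 4" for x
        unfolding B_def
      proof (rule zero_free_lower_bound[where g = "phi \<alpha>", OF _ phi0(1) _ _ \<delta> x])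
        show "cmod (phi \<alpha> z) < exp (log_growth 2 + 1)" if "cmod z < 1 + \<delta>" for z
          using phi_growth[OF \<alpha>(1), of 2 z] that \<delta> by (smt (verit) exp_less_cancel_iff)
      qed (use nz holomorphic_phi[OF \<alpha>(1)] in \<open>auto intro: holomorphic_on_subset\<close>)
      obtain \<kappa> where \<kappa>: "0 < \<kappa>" "\<kappa> \<le> 1" "\<And>z. z \<noteq> 0 \<Longrightarrow> jost_a \<alpha> z * cnj (jost_a \<alpha> (1 / cnj z)) - jost_b \<alpha> z * cnj (jost_b \<alpha> (1 / cnj z)) = of_real \<kappa>"
        using jost_reflection[OF \<alpha>(1)] by blast
      obtain \<kappa>' where \<kappa>': "0 < \<kappa>'" "\<And>z. z \<noteq> 0 \<Longrightarrow> jost_a \<alpha>' z * cnj (jost_a \<alpha>' (1 / cnj z)) - jost_b \<alpha>' z * cnj (jost_b \<alpha>' (1 / cnj z)) = of_real \<kappa>'"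
        using jost_reflection[OF \<alpha>(2)] by blast
      have "cmod (jost_b \<alpha> z / jost_a \<alpha> z - jost_b \<alpha>' z / jost_a \<alpha>' z) \<le> K2 * err" if z: "cmod z = 1" for z
      proof -
        define a b a' b' where ab: "a = jost_a \<alpha> z" "b = jost_b \<alpha> z" "a' = jost_a \<alpha>' z" "b' = jost_b \<alpha>' z"
        have G: "cmod ((a - z * b) / phi \<alpha> z - (a' - z * b') / phi \<alpha>' z) \<le> cmod z * (120 * exp (2 * B) / \<delta> * \<theta>)"
          unfolding ab
          by (rule caratheodory_stability[where a = "jost_a \<alpha>" and b = "jost_b \<alpha>" and a' = "jost_a \<alpha>'" and b' = "jost_b \<alpha>'", OF holomorphic_jost[OF \<alpha>(1)] holomorphic_jost[OF \<alpha>(2)]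
              jost_a_at_0[OF \<alpha>(1)] jost_a_at_0[OF \<alpha>(2)] \<kappa>(1,2) \<kappa>'(1) \<kappa>(3) \<kappa>'(2) _ _ _ _ _ \<delta>,
              folded phi_def]) (use nz lb near small z in \<open>auto simp: \<theta>_def\<close>)
        have nn: "a \<noteq> 0" "a' \<noteq> 0" "phi \<alpha> z \<noteq> 0" "phi \<alpha>' z \<noteq> 0"
          using jost_Schur(2)[OF \<alpha>(1), of z] jost_Schur(2)[OF \<alpha>(2), of z] nz[of z] z \<delta> by (auto simp: ab)
        have p: "phi \<alpha> z = a + z * b" "phi \<alpha>' z = a' + z * b'" by (simp_all add: phi_def ab)
        have r2: "cmod (phi \<beta> z / jost_a \<beta> z) \<le> 2" if \<beta>: "\<beta> \<in> cls" for \<beta>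
        proof -
          have "phi \<beta> z / jost_a \<beta> z = 1 + z * (jost_b \<beta> z / jost_a \<beta> z)"
            using jost_Schur(2)[OF \<beta>, of z] z by (simp add: phi_def add_divide_distrib)
          also have "cmod \<dots> \<le> cmod 1 + cmod (z * (jost_b \<beta> z / jost_a \<beta> z))" by (rule norm_triangle_ineq)
          also have "\<dots> \<le> 2" using norm_Schur_le[OF \<beta>, of z] z by (simp only: norm_mult) simp
          finally show ?thesis .
        qed
        \<comment> \<open>With f = b / a the Caratheodory function is (1 - z f) / (1 + z f). Undoing
          this map multiplies the difference by the two factors phi / a = 1 + z f, each at most 2 in
          modulus.\<close>
        have "2 * z * (b / a - b' / a') = - ((a - z * b) / phi \<alpha> z - (a' - z * b') / phi \<alpha>' z) * (phi \<alpha> z / a) * (phi \<alpha>' z / a')"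
        proof -
          have "((a - z * b) / phi \<alpha> z - (a' - z * b') / phi \<alpha>' z) * (phi \<alpha> z * phi \<alpha>' z) = (a - z * b) * phi \<alpha>' z - (a' - z * b') * phi \<alpha> z"
            using nn(3,4) by (metis (no_types, lifting) diff_frac_eq divide_eq_eq no_zero_divisors)
          also have "\<dots> = - (2 * z * (b * a' - b' * a))" unfolding p by (simp add: algebra_simps)
          finally show ?thesis using nn by (simp add: divide_simps)
        qed
        then have "cmod (2 * z * (b / a - b' / a')) = cmod ((a - z * b) / phi \<alpha> z - (a' - z * b') / phi \<alpha>' z) * cmod (phi \<alpha> z / a) * cmod (phi \<alpha>' z / a')"
          by (simp only: norm_mult norm_minus_cancel)
        also have "\<dots> \<le> cmod z * (120 * exp (2 * B) / \<delta> * \<theta>) * 2 * 2"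
          using G r2[OF \<alpha>(1)] r2[OF \<alpha>(2)] K1 err0 \<delta> unfolding ab
          by (intro mult_mono) (auto simp: \<theta>_def)
        finally have "2 * cmod (b / a - b' / a') \<le> 120 * exp (2 * B) / \<delta> * \<theta> * 4"
          by (simp add: norm_mult z)
        then show ?thesis unfolding ab[symmetric] by (simp add: K2_def \<theta>_def)
      qed
      then have "cmod (\<alpha> (Suc n) - \<alpha>' (Suc n)) \<le> (6 * Q\<^sup>2) ^ n * (K2 * err)"
        by (intro Schur_algorithm_stability \<alpha>)
      also have "\<dots> \<le> (6 * Q\<^sup>2) ^ n * ((8 * K1 + K2) * err)"
        using K1 err0 Q6[of n] by (intro mult_left_mono mult_right_mono) auto
      finally show ?thesis by (simp add: err_def[symmetric] mult_ac)
    qed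
  qed
  have "8 * K1 + K2 > 0" using K1 K2 by simp
  then show ?thesis using main by blast
qed

end

theorem theorem1p2:
  fixes \<gamma> \<eta> Q R\<^sub>0 :: real
  assumes "\<gamma> > 1" and "\<eta> > 0" and "Q > 1" and "R\<^sub>0 > 1"
  shows "\<exists>A\<^sub>0::real. \<forall>\<delta>>0.
    (\<forall>\<beta>\<in>B0 \<gamma> \<eta> Q. \<forall>z. cmod z < 1 + \<delta> \<longrightarrow> \<not> resonance (cmv \<beta>) z) \<longrightarrow>
    (\<forall>\<alpha>\<in>B0 \<gamma> \<eta> Q. \<forall>\<alpha>'\<in>B0 \<gamma> \<eta> Q. \<forall>U U'. \<forall>R \<epsilon> :: real.
       U = cmv \<alpha> \<longrightarrow> U' = cmv \<alpha>' \<longrightarrow>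
       R \<ge> R\<^sub>0 \<longrightarrow> 0 < \<epsilon> \<longrightarrow> \<epsilon> < \<delta> / 2 \<longrightarrow>
       resonances_respectively_close \<epsilon> R U U' \<longrightarrow>
       (\<forall>n\<ge>1. cmod (\<alpha> n - \<alpha>' n) \<le>
          A\<^sub>0 * (6 * Q\<^sup>2) ^ n * (\<epsilon> + ln R powr (\<gamma> / (\<gamma> - 1)) / R)))"
proof (cases "\<exists>\<delta>>0. \<forall>\<beta>\<in>B0 \<gamma> \<eta> Q. \<forall>z. cmod z < 1 + \<delta> \<longrightarrow> \<not> resonance (cmv \<beta>) z")
  case True
  interpret verblunsky_decay \<gamma> \<eta> Q by unfold_locales (use assms in auto)
  \<comment> \<open>A zero-free radius fixed once and for all; this makes \<open>A\<^sub>0\<close> independent of \<open>\<delta>\<close>.\<close>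
  obtain \<delta>\<^sub>1 where \<delta>1: "\<delta>\<^sub>1 > 0" "\<And>\<beta> z. \<beta> \<in> B0 \<gamma> \<eta> Q \<Longrightarrow> cmod z < 1 + \<delta>\<^sub>1 \<Longrightarrow> \<not> resonance (cmv \<beta>) z"
    using True by blast
  \<comment> \<open>The cap at 1 meets the condition \<delta> <= 1 of the estimates above.\<close>
  define \<delta>\<^sub>0 where "\<delta>\<^sub>0 = min 1 \<delta>\<^sub>1"
  have \<delta>0: "0 < \<delta>\<^sub>0" "\<delta>\<^sub>0 \<le> 1" using \<delta>1 by (auto simp: \<delta>\<^sub>0_def)
  obtain K where K: "K > 0" and main: "\<And>\<alpha> \<alpha>' R \<epsilon> n. \<alpha> \<in> cls \<Longrightarrow> \<alpha>' \<in> cls \<Longrightarrow>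
      (\<And>z. cmod z < 1 + \<delta>\<^sub>0 \<Longrightarrow> phi \<alpha> z \<noteq> 0 \<and> phi \<alpha>' z \<noteq> 0) \<Longrightarrow> R \<ge> 4 \<Longrightarrow> \<epsilon> > 0 \<Longrightarrow>
      resonances_respectively_close \<epsilon> R (cmv \<alpha>) (cmv \<alpha>') \<Longrightarrow>
      cmod (\<alpha> (Suc n) - \<alpha>' (Suc n)) \<le> K * (6 * Q\<^sup>2) ^ n * (\<epsilon> + ln R powr growth_exponent / R)"
    using stability_zero_free[OF \<delta>0] by blast
  \<comment> \<open>For \<open>R\<^sub>0\<close> <= R < 4 the term (ln R)^p / R, with p = \<gamma> /
    (\<gamma> - 1), is at least l / 4, so 8 / l times the error covers the trivial bound 2.\<close>
  define l where "l = ln R\<^sub>0 powr growth_exponent"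
  have l: "l > 0" using assms(4) by (simp add: l_def)
  define A where "A = K + 8 / l"
  have Q6: "(6 * Q\<^sup>2) ^ m \<ge> 1" "(6 * Q\<^sup>2) ^ m \<le> (6 * Q\<^sup>2) ^ Suc m" for m
  proof -
    have "1 \<le> Q\<^sup>2" using Q by (intro one_le_power) simp
    then have "1 \<le> 6 * Q\<^sup>2" by simp
    then show "(6 * Q\<^sup>2) ^ m \<ge> 1" "(6 * Q\<^sup>2) ^ m \<le> (6 * Q\<^sup>2) ^ Suc m"
      by (intro one_le_power power_increasing; simp)+
  qed
  have "cmod (\<alpha> n - \<alpha>' n) \<le> A * (6 * Q\<^sup>2) ^ n * (\<epsilon> + ln R powr growth_exponent / R)"
    if \<alpha>: "\<alpha> \<in> B0 \<gamma> \<eta> Q" "\<alpha>' \<in> B0 \<gamma> \<eta> Q" and R: "R \<ge> R\<^sub>0" and \<epsilon>: "0 < \<epsilon>"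
      and close: "resonances_respectively_close \<epsilon> R (cmv \<alpha>) (cmv \<alpha>')" and n: "n \<ge> 1" for \<alpha> \<alpha>' R \<epsilon> n
  proof -
    define err where "err = \<epsilon> + ln R powr growth_exponent / R"
    have R1: "R > 1" using R assms(4) by simp
    have err: "err > 0" using \<epsilon> R1 by (simp add: err_def add_pos_nonneg)
    have cls: "\<alpha> \<in> cls" "\<alpha>' \<in> cls" using \<alpha> B0_subset_cls by auto
    obtain m where m: "n = Suc m" using n by (cases n) auto
    have "cmod (\<alpha> n - \<alpha>' n) \<le> A * err * (6 * Q\<^sup>2) ^ m"
    proof (cases "R \<ge> 4")
      case True
      have "cmod (\<alpha> (Suc m) - \<alpha>' (Suc m)) \<le> K * (6 * Q\<^sup>2) ^ m * (\<epsilon> + ln R powr growth_exponent / R)"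
      proof (rule main[OF cls _ True \<epsilon> close])
        show "phi \<alpha> z \<noteq> 0 \<and> phi \<alpha>' z \<noteq> 0" if "cmod z < 1 + \<delta>\<^sub>0" for z
          using \<delta>1(2)[OF \<alpha>(1), of z] \<delta>1(2)[OF \<alpha>(2), of z] that
          by (simp add: \<delta>\<^sub>0_def resonance_iff[OF cls(1)] resonance_iff[OF cls(2)])
      qed
      also have "\<dots> = K * err * (6 * Q\<^sup>2) ^ m" by (simp add: err_def)
      also have "\<dots> \<le> A * err * (6 * Q\<^sup>2) ^ m"
        using l err Q6(1)[of m] by (intro mult_right_mono) (auto simp: A_def)
      finally show ?thesis by (simp add: m)
    next
      case False
      have "l / 4 \<le> ln R powr growth_exponent / R"
        unfolding l_def using R R1 False assms(4) growth_exponent_gt_1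
        by (intro frac_le powr_mono2) auto
      then have "l / 4 \<le> err" using \<epsilon> by (simp add: err_def)
      then have "2 \<le> 8 / l * err" using l by (simp add: field_simps)
      also have "\<dots> \<le> A * err" using K err by (intro mult_right_mono) (auto simp: A_def)
      also have "\<dots> \<le> A * err * (6 * Q\<^sup>2) ^ m"
        using mult_left_mono[OF Q6(1)[of m], of "A * err"] K l err by (simp add: A_def)
      finally have "2 \<le> A * err * (6 * Q\<^sup>2) ^ m" .
      moreover have "cmod (\<alpha> n - \<alpha>' n) \<le> 1 + 1"
        using cls_lt_1[OF cls(1), of m] cls_lt_1[OF cls(2), of m] unfolding m
        by (intro order_trans[OF norm_triangle_ineq4] add_mono) auto
      ultimately show ?thesis by linarith
    qed
    \<comment> \<open>The estimate so far has the exponent m = n - 1, which is enlarged to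
      n.\<close>
    also have "\<dots> \<le> A * err * (6 * Q\<^sup>2) ^ n"
      unfolding m using Q6(2)[of m] K l err by (intro mult_left_mono) (auto simp: A_def)
    finally show ?thesis by (simp add: err_def mult_ac)
  qed
  then show ?thesis by blast
next
  \<comment> \<open>Without a common zero-free radius no \<delta> meets the hypothesis, and any
    constant will do.\<close>
  case False
  then show ?thesis by blast
qed

end
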